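(* Let $G=(V,E)$ be a strongly connected digraph on $V=\{1,\dots,N\}$ without self loops, let $m>0$, $\kappa>0$, $0<\alpha<\frac{\pi}{2}$, $\Omega_1,\dots,\Omega_N\in\mathbb{R}$, and let $\theta(t)=(\theta_1(t),\dots,\theta_N(t))$ be a solution, with $\omega_i=\dot\theta_i$, of $$m\ddot\theta_i(t)+\dot\theta_i(t)=\Omega_i+\kappa\sum_{j\in\mathcal N_i}\sin(\theta_j(t)-\theta_i(t)+\alpha),\quad t>0,\qquad (\theta_i(0),\omega_i(0))=(\theta_{i0},\omega_{i0}),\quad i\in V.$$ Suppose $D_\theta(0)<\pi$. Suppose that the coupling strength $\kappa$ is sufficiently large and the inertia $m$ and frustration $\alpha$ are sufficiently small, in the following precise sense: there are constants $\gamma$ with $D_\theta(0)<\gamma<\pi$, $\gamma>0$, $D^\infty\in(0,\frac{\pi}{2})$ with $D^\infty+\alpha<\frac{\pi}{2}$, $\varepsilon\in(0,1)$, and an integer $c>2$ such that, with $\eta=1-\frac{4}{c+2}$, $M_N=\prod_{i=0}^{N-2}(c+i)$ and $$\Lambda=\min\Big\{\frac{\eta\kappa\cos\alpha\sin\gamma}{\gamma M_N},\ \frac1m-\frac{8N^2\kappa\gamma M_N}{\eta^3\sin\gamma},\ \frac1{2m}\Big\},$$ the following hold: (i) $c>\max\big\{\frac{N\gamma}{\sin\gamma},\frac{N}{\cos(D^\infty+\alpha)}\big\}$ and $D_\theta(0)<\eta(1-\varepsilon)\gamma$; (ii) $m\kappa<\frac{\eta^3}{8N^2M_N}\min\big\{\frac{\sin\gamma}{\gamma},\cos(D^\infty+\alpha)\big\}$;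 (iii) $D_\theta(0)+\frac{\eta^2\sin\gamma}{2N\gamma M_N}\,mD_\omega(0)+2m^2D_a(0)<\eta(1-\varepsilon)\gamma<\pi$; (iv) $\frac{2(D_\Omega+2N\kappa\sin\alpha)}{\eta\Lambda}<\min\big\{(1-\varepsilon)\gamma,\frac{D^\infty}{2}\big\}$; (v) $4NmM_N(D_\omega(0)+D_\Omega)+8N^2m\kappa M_N<\eta^2\cos(D^\infty+\alpha)$. Then there exist a finite time $t_*\ge 0$ and positive constants $C,\tilde\Lambda$ (depending on the system parameters) such that $$D_\omega(t)\le Ce^{-\tilde\Lambda(t-t_* )},\qquad t\ge t_*.$$
   Context: $N\ge2$. $\mathcal N_i=\{j:(j,i)\in E\}$ is the neighbor set of vertex $i$, and $i\notin\mathcal N_i$. A path from $i_1$ to $i_k$ is a sequence $i_1,\dots,i_k$ with $i_s\in\mathcal N_{i_{s+1}}$ for $1\le s\le k-1$; $G$ is strongly connected if each vertex can be reached by a path from any other vertex. Write $\omega_i=\dot\theta_i$, $a_i=\dot\omega_i$, where at $t=0$, $a_i(0)=\frac1m\big(-\omega_i(0)+\Omega_i+\kappa\sum_{j\in\mathcal N_i}\sin(\theta_j(0)-\theta_i(0)+\alpha)\big)$. For $z\in\{\theta,\omega,a\}$, $D_z(t)=\max_i z_i(t)-\min_i z_i(t)$, and $D_\Omega=\max_i\Omega_i-\min_i\Omega_i$. *)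

theory Defs
  imports
    Complex_Main
    "Graph_Theory.Digraph_Component"
    "Graph_Theory.Pair_Digraph"
begin

(* An arc (j, i) is read "j influences i". *)
definition neighbors :: "nat pair_pre_digraph \<Rightarrow> nat \<Rightarrow> nat set" where
  "neighbors G i = {j. (j, i) \<in> parcs G}"

definition diam :: "nat set \<Rightarrow> (nat \<Rightarrow> real) \<Rightarrow> real" where
  "diam V z = Max (z ` V) - Min (z ` V)"

definition kuramoto_rhs ::
  "nat pair_pre_digraph \<Rightarrow> real \<Rightarrow> real \<Rightarrow> (nat \<Rightarrow> real) \<Rightarrow> (nat \<Rightarrow> real) \<Rightarrow> nat \<Rightarrow> real" where
  "kuramoto_rhs G \<kappa> \<alpha> \<Omega> x i =
     \<Omega> i + \<kappa> * (\<Sum>j\<in>neighbors G i. sin (x j - x i + \<alpha>))"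

(* Global classical solution on [0, infinity): theta is C^1 up to t = 0, where its derivative
   omega is one-sided, and the second-order equation holds for t > 0.
   The acceleration at t = 0 is fixed by the equation and the initial data. *)
definition inertial_kuramoto_solution ::
  "nat pair_pre_digraph \<Rightarrow> real \<Rightarrow> real \<Rightarrow> real \<Rightarrow> (nat \<Rightarrow> real) \<Rightarrow>
   (nat \<Rightarrow> real) \<Rightarrow> (nat \<Rightarrow> real) \<Rightarrow>
   (nat \<Rightarrow> real \<Rightarrow> real) \<Rightarrow> (nat \<Rightarrow> real \<Rightarrow> real) \<Rightarrow> (nat \<Rightarrow> real \<Rightarrow> real) \<Rightarrow> bool" where
  "inertial_kuramoto_solution G m \<kappa> \<alpha> \<Omega> \<theta>0 \<omega>0 \<theta> \<omega> a \<longleftrightarrow>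
     (\<forall>i\<in>pverts G.
        \<theta> i 0 = \<theta>0 i \<and> \<omega> i 0 = \<omega>0 i \<and>
        (\<forall>t\<ge>0. (\<theta> i has_real_derivative \<omega> i t) (at t within {0..})) \<and>
        continuous_on {0..} (\<omega> i) \<and>
        (\<forall>t>0. (\<omega> i has_real_derivative a i t) (at t) \<and>
               m * a i t + \<omega> i t = kuramoto_rhs G \<kappa> \<alpha> \<Omega> (\<lambda>j. \<theta> j t) i) \<and>
        a i 0 = (1 / m) * (- \<omega> i 0 + kuramoto_rhs G \<kappa> \<alpha> \<Omega> (\<lambda>j. \<theta> j 0) i))"

end

theory Submission
  imports Defs "HOL-Analysis.Elementary_Metric_Spaces" "HOL-Combinatorics.Permutations"
begin

text \<open>
  The acceleration makes the phases \<open>\<theta>\<close> a delayed copy of the slow phases \<open>u = \<theta> + m * \<omega>\<close>: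
  the derivative of \<open>u\<close> is the full coupling force, whereas \<open>\<theta>\<close> is an exponentially weighted
  average of \<open>u\<close>. The slow phases obey a first-order consensus system whose coupling reads
  \<open>u - v\<close> instead of \<open>u\<close>, where the lag \<open>v = m * \<omega>\<close> relaxes on the short time scale \<open>m\<close>.

  On a digraph that is only strongly connected the diameter of \<open>u\<close> need not shrink at every
  instant, since a vertex of extreme phase may have neighbours only at the same extreme. The proof
  replaces the diameter by the spread between two weighted means. Sort the vertices by phase and give
  each position \<open>c\<close> times the total weight of the lower positions; the largest mean arises from this
  order and the smallest from the reverse order. Across every gap between consecutive phases some arc
  pulls back (strong connectivity), and its weight beats all the arcs below the gap that pull towards
  the extreme, because \<open>c\<close> exceeds the number of vertices divided by the smallest coupling
  coefficient. So the top mean decreases at a rate proportional to the diameter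
  (\<open>sorted_cascade_dissipation\<close>, \<open>top_mean_dissipation\<close>), and the spread of the means differs from
  the diameter only by the factor \<open>(c - 1) / (c + 1)\<close> (\<open>D_le_ranked_spread\<close>).

  Adding a small multiple of the diameter of the lag gives an energy \<open>E\<close> with
  \<open>E' \<le> (1 + \<beta>) * P - A * E\<close> for a positive rate \<open>A\<close>, where \<open>P\<close> bounds the heterogeneity
  (\<open>spread_energy_dissipation\<close>). As a maximum of finitely many smooth functions it is compared with
  explicit barriers at first crossings (\<open>finite_family_stays_below\<close>).

  The estimate is used twice. For the slow phases the coupling coefficients are \<open>sin z / z\<close>, bounded
  below as long as the phases span at most \<open>\<gamma> < pi\<close>; the energy keeps them there and drives the
  phase diameter below \<open>Dinf\<close> in finite time (\<open>phase_spread_eventually_le\<close>). From then on the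
  differentiated system has the same form, with coefficients \<open>cos (\<theta> j - \<theta> i + \<alpha>)\<close> bounded below
  by \<open>cos (Dinf + \<alpha>)\<close> and without heterogeneity, so its energy and with it the frequency diameter
  decay exponentially (\<open>frequency_spread_decays\<close>).
\<close>

section \<open>Comparison for finite families of functions\<close>

text \<open>A maximum of finitely many smooth functions is not differentiable where the maximiser changes, so
  it satisfies a differential inequality only at the active members. The comparison principle
  survives: at the first time at which some member reaches the barrier, that member is active and has
  come from below, so its slope is at least the slope of the barrier.\<close>
lemma finite_family_stays_below:
  fixes e e' :: "'k \<Rightarrow> real \<Rightarrow> real" and L L' :: "real \<Rightarrow> real"
  assumes fin: "finite K"
    and cont: "\<And>k. k \<in> K \<Longrightarrow> continuous_on {start..} (e k)" and contL: "continuous_on {start..} L"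
    and der: "\<And>k t. k \<in> K \<Longrightarrow> t > start \<Longrightarrow> (e k has_real_derivative e' k t) (at t)"
    and derL: "\<And>t. t > start \<Longrightarrow> (L has_real_derivative L' t) (at t)"
    and init: "\<And>k. k \<in> K \<Longrightarrow> e k start < L start"
    and slope: "\<And>k t. k \<in> K \<Longrightarrow> t > start \<Longrightarrow> (\<And>l. l \<in> K \<Longrightarrow> e l t \<le> L t) \<Longrightarrow> e k t = L t
                  \<Longrightarrow> e' k t < L' t"
    and k: "k \<in> K" and t: "t \<ge> start"
  shows "e k t < L t"
proof (rule ccontr)
  assume neg: "\<not> e k t < L t"
  define B where "B = (\<Union>l\<in>K. {s \<in> {start..}. L s \<le> e l s})"
  have "closed B"
    unfolding B_def
    using fin cont contL by (intro closed_UN ballI continuous_on_closed_Collect_le) auto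
  moreover have "t \<in> B" using neg k t by (force simp: B_def not_less)
  moreover have bdd: "bdd_below B" by (auto simp: B_def intro!: bdd_belowI[of _ start])
  ultimately have "Inf B \<in> B" using closed_contains_Inf by blast
  define t1 where "t1 = Inf B"
  obtain q where q: "q \<in> K" "L t1 \<le> e q t1" and "start \<le> t1"
    using \<open>Inf B \<in> B\<close> by (auto simp: B_def t1_def)
  have t1: "t1 > start" using init[OF q(1)] q(2) \<open>start \<le> t1\<close> by (cases "t1 = start") auto
  have before: "e l s < L s" if "l \<in> K" "start \<le> s" "s < t1" for l s
  proof (rule ccontr)
    assume "\<not> e l s < L s"
    then have "s \<in> B" using that by (force simp: B_def not_less)
    then show False using cInf_lower[OF _ bdd] that(3) by (fastforce simp: t1_def)
  qed
  have at_t1: "e l t1 \<le> L t1" if "l \<in> K" for l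
  proof (rule tendsto_le)
    show "((\<lambda>s. L s) \<longlongrightarrow> L t1) (at_left t1)" "((\<lambda>s. e l s) \<longlongrightarrow> e l t1) (at_left t1)"
      using DERIV_isCont[OF derL[OF t1]] DERIV_isCont[OF der[OF that t1]]
      by (auto simp: isCont_def intro: filterlim_at_split[THEN iffD1, THEN conjunct1])
    show "\<forall>\<^sub>F s in at_left t1. e l s \<le> L s"
      using eventually_at_left_real[OF t1]
      by eventually_elim (auto intro!: less_imp_le before[OF that])
  qed auto
  have eq: "e q t1 = L t1" using at_t1[OF q(1)] q(2) by simp
  have "e' q t1 - L' t1 < 0" using slope[OF q(1) t1 at_t1 eq] by simp
  moreover have "((\<lambda>s. e q s - L s) has_real_derivative e' q t1 - L' t1) (at t1)"
    using der[OF q(1) t1] derL[OF t1] by (rule DERIV_diff)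
  ultimately obtain d where d: "d > 0" "\<And>h. h > 0 \<Longrightarrow> h < d \<Longrightarrow> e q t1 - L t1 < e q (t1 - h) - L (t1 - h)"
    using DERIV_neg_dec_left by (metis (no_types, lifting))
  define h where "h = min (d/2) (t1 - start)"
  have "0 < h" "h < d" "start \<le> t1 - h" using d t1 by (auto simp: h_def)
  then show False using d(2)[of h] before[OF q(1), of "t1 - h"] eq by auto
qed

section \<open>Sorted values with cascading weights\<close>

text \<open>From position 2 on, each weight is exactly \<open>c\<close> times the sum of all weights below it. The
  partial sums are therefore powers of \<open>1 + c\<close>, and what happens at one position outweighs
  everything that happens below it.\<close>
definition cascade_weight :: "real \<Rightarrow> nat \<Rightarrow> real" where
  "cascade_weight c p = (if p \<le> 1 then 1 else c * (1 + c) ^ (p - 2))"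

lemma sum_cascade_weight:
  "n \<ge> 1 \<Longrightarrow> (\<Sum>p=1..n. cascade_weight c p) = (1 + c) ^ (n - 1)"
proof (induction n rule: dec_induct)
  case base
  show ?case by (simp add: cascade_weight_def)
next
  case (step n)
  obtain q where "n = Suc q" using step by (cases n) auto
  then show ?case using step by (simp add: cascade_weight_def algebra_simps)
qed

lemma cascade_weight_pos: "c > 0 \<Longrightarrow> cascade_weight c p > 0"
  by (simp add: cascade_weight_def)

lemma cascade_weight_strict_mono:
  assumes "c > 1" "1 \<le> p" "p < q"
  shows "cascade_weight c p < cascade_weight c q"
proof -
  have "cascade_weight c p \<le> (\<Sum>r=1..q-1. cascade_weight c r)"
    using assms by (intro member_le_sum) (auto intro!: less_imp_le cascade_weight_pos)
  also have "\<dots> = (1 + c) ^ (q - 2)"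
    using assms by (subst sum_cascade_weight) (auto simp: numeral_2_eq_2)
  also have "\<dots> < c * (1 + c) ^ (q - 2)" using assms by simp
  finally show ?thesis using assms by (simp add: cascade_weight_def)
qed

text \<open>Here \<open>y\<close> lists the values in increasing order and \<open>B k\<close> the positions that pull on position
  \<open>k\<close>. Write every difference as a sum of the gaps \<open>y p - y (p - 1)\<close> and collect the coefficient
  of the gap at \<open>p\<close>. It gets a positive contribution only from arcs that pull a position below
  \<open>p\<close> up across the gap: at most \<open>N + 1 - p\<close> of them for each position, with total weight
  \<open>(1 + c) ^ (p - 2)\<close>. By \<open>cut\<close> at least one arc pulls down across the gap, and it acts on a
  position with weight at least \<open>c * (1 + c) ^ (p - 2)\<close>. Since \<open>N \<le> s * c\<close>, the downward pull
  wins with a margin of at least 1 in each gap.\<close>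
lemma sorted_cascade_dissipation:
  fixes y :: "nat \<Rightarrow> real" and r :: "nat \<Rightarrow> nat \<Rightarrow> real" and B :: "nat \<Rightarrow> nat set"
  assumes N: "N \<ge> 1" and c: "c > 1" and s: "0 \<le> s" "real N \<le> s * c"
    and mono: "\<And>p. p \<in> {2..N} \<Longrightarrow> y (p - 1) \<le> y p"
    and B: "\<And>k. k \<in> {1..N} \<Longrightarrow> B k \<subseteq> {1..N}"
    and cut: "\<And>p. p \<in> {2..N} \<Longrightarrow> \<exists>k\<in>{p..N}. \<exists>l\<in>B k. l < p"
    and r: "\<And>k l. k \<in> {1..N} \<Longrightarrow> l \<in> B k \<Longrightarrow> s \<le> r k l \<and> r k l \<le> 1"
  shows "(\<Sum>k=1..N. cascade_weight c k * (\<Sum>l\<in>B k. r k l * (y l - y k))) \<le> - (y N - y 1)"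
proof -
  let ?w = "cascade_weight c"
  define g where "g p = y p - y (p - 1)" for p
  \<comment> \<open>The gap at \<open>p\<close> counts for position \<open>l\<close> exactly if \<open>\<chi> p l = 1\<close>, and \<open>T p k\<close> below is the net flow that position \<open>k\<close> receives across that gap.\<close>
  define \<chi> :: "nat \<Rightarrow> nat \<Rightarrow> real" where "\<chi> p l = of_bool (p \<le> l)" for p l
  have g: "0 \<le> g p" if "p \<in> {2..N}" for p using mono[OF that] by (simp add: g_def)
  have finB: "finite (B k)" if "k \<in> {1..N}" for k using B[OF that] finite_subset by blast
  have wpos: "?w p > 0" for p using c by (intro cascade_weight_pos) auto
  have telescope: "y l = y 1 + (\<Sum>p=2..N. g p * \<chi> p l)" if "l \<in> {1..N}" for l
  proof -
    have "(\<Sum>p=2..l. g p) = y l - y 1" if "l \<ge> 1" for l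
      using that by (induction l rule: dec_induct) (auto simp: g_def)
    moreover have "(\<Sum>p=2..N. g p * \<chi> p l) = (\<Sum>p\<in>{2..N}. if p \<le> l then g p else 0)"
      by (intro sum.cong) (auto simp: \<chi>_def)
    moreover have "\<dots> = (\<Sum>p\<in>{p\<in>{2..N}. p \<le> l}. g p)" by (rule sum.inter_filter[symmetric]) simp
    moreover have "{p\<in>{2..N}. p \<le> l} = {2..l}" using that by auto
    ultimately show ?thesis using that by simp
  qed
  define T where "T p k = (\<Sum>l\<in>B k. r k l * (\<chi> p l - \<chi> p k))" for p k
  have cut_flow: "(\<Sum>k=1..N. ?w k * T p k) \<le> -1" if p: "p \<in> {2..N}" for p
  proof -
    obtain k0 l0 where k0: "k0 \<in> {p..N}" and l0: "l0 \<in> B k0" "l0 < p" using cut[OF p] by blast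
    have low: "T p k \<le> real (N + 1 - p)" if k: "k \<in> {1..p-1}" for k
    proof -
      have kN: "k \<in> {1..N}" using k p by auto
      have "T p k \<le> (\<Sum>l\<in>B k. of_bool (l \<in> {p..N}))"
        unfolding T_def
      proof (rule sum_mono)
        fix l assume l: "l \<in> B k"
        show "r k l * (\<chi> p l - \<chi> p k) \<le> of_bool (l \<in> {p..N})"
          using r[OF kN l] B[OF kN] l k s by (auto simp: \<chi>_def)
      qed
      also have "\<dots> = real (card (B k \<inter> {p..N}))" using finB[OF kN]
        by (simp flip: sum.inter_restrict add: of_bool_def sum.If_cases Int_def)
      also have "\<dots> \<le> real (card {p..N})" by (intro of_nat_mono card_mono) auto
      finally show ?thesis by simp
    qed
    have high: "T p k \<le> (if k = k0 then - s else 0)" if k: "k \<in> {p..N}" for k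
    proof -
      have kN: "k \<in> {1..N}" using k p by auto
      have t: "r k l * (\<chi> p l - \<chi> p k) \<le> (if k = k0 \<and> l = l0 then - s else 0)" if l: "l \<in> B k" for l
        using r[OF kN l] k s l0 by (auto simp: \<chi>_def)
      have "T p k \<le> (\<Sum>l\<in>B k. if k = k0 \<and> l = l0 then - s else 0)"
        unfolding T_def by (intro sum_mono t)
      also have "\<dots> = (if k = k0 then - s else 0)"
        using finB[OF kN] l0 by (cases "k = k0") (auto simp: sum.delta)
      finally show ?thesis .
    qed
    have split: "{1..N} = {1..p-1} \<union> {p..N}" using p by auto
    have "(\<Sum>k=1..N. ?w k * T p k) = (\<Sum>k=1..p-1. ?w k * T p k) + (\<Sum>k=p..N. ?w k * T p k)"
      unfolding split using p by (intro sum.union_disjoint) auto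
    also have "\<dots> \<le> (\<Sum>k=1..p-1. ?w k * real (N + 1 - p)) + (\<Sum>k=p..N. if k = k0 then - (?w k * s) else 0)"
    proof (intro add_mono sum_mono)
      fix k assume "k \<in> {1..p-1}"
      then show "?w k * T p k \<le> ?w k * real (N + 1 - p)" using low wpos[of k] by simp
    next
      fix k assume "k \<in> {p..N}"
      from mult_left_mono[OF high[OF this] less_imp_le[OF wpos[of k]]]
      show "?w k * T p k \<le> (if k = k0 then - (?w k * s) else 0)" by (auto split: if_splits)
    qed
    also have "\<dots> = (1 + c) ^ (p - 2) * real (N + 1 - p) - ?w k0 * s"
      using k0 p sum_cascade_weight[of "p - 1" c]
      by (auto simp: sum_distrib_right[symmetric] numeral_2_eq_2)
    also have "\<dots> \<le> (1 + c) ^ (p - 2) * real (N + 1 - p) - c * (1 + c) ^ (p - 2) * s"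
    proof -
      have "?w p \<le> ?w k0"
        using cascade_weight_strict_mono[OF c, of p k0] k0 p by (cases "p = k0") auto
      then have "?w p * s \<le> ?w k0 * s" using s by (intro mult_right_mono) auto
      moreover have "?w p = c * (1 + c) ^ (p - 2)" using p by (simp add: cascade_weight_def)
      ultimately show ?thesis by simp
    qed
    also have "\<dots> = (1 + c) ^ (p - 2) * (real (N + 1 - p) - s * c)" by (simp add: algebra_simps)
    also have "\<dots> \<le> (1 + c) ^ (p - 2) * (-1)"
      using c s p by (intro mult_left_mono) (auto simp: of_nat_diff)
    also have "\<dots> \<le> -1" using c by (simp add: one_le_power)
    finally show ?thesis .
  qed
  have "(\<Sum>k=1..N. ?w k * (\<Sum>l\<in>B k. r k l * (y l - y k)))
        = (\<Sum>k=1..N. ?w k * (\<Sum>l\<in>B k. \<Sum>p=2..N. g p * (r k l * (\<chi> p l - \<chi> p k))))"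
  proof (intro sum.cong arg_cong2[where f = "(*)"] refl)
    fix k l assume k: "k \<in> {1..N}" and l: "l \<in> B k"
    have "y l - y k = (\<Sum>p=2..N. g p * (\<chi> p l - \<chi> p k))"
      using telescope[OF k] telescope[of l] B[OF k] l
      by (auto simp: sum_subtractf algebra_simps)
    then show "r k l * (y l - y k) = (\<Sum>p=2..N. g p * (r k l * (\<chi> p l - \<chi> p k)))"
      by (simp add: sum_distrib_left mult_ac)
  qed
  also have "\<dots> = (\<Sum>k=1..N. \<Sum>p=2..N. g p * (?w k * T p k))"
    unfolding T_def by (subst sum.swap) (simp add: sum_distrib_left mult_ac)
  also have "\<dots> = (\<Sum>p=2..N. g p * (\<Sum>k=1..N. ?w k * T p k))"
    by (subst sum.swap) (simp add: sum_distrib_left)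
  also have "\<dots> \<le> (\<Sum>p=2..N. g p * (-1))"
    using g cut_flow by (intro sum_mono mult_left_mono) auto
  also have "\<dots> = - (y N - y 1)"
    using telescope[of N] N by (simp add: \<chi>_def sum_negf)
  finally show ?thesis .
qed

text \<open>The rearrangement inequality, localised: swapping the nodes at positions \<open>p - 1\<close> and \<open>p\<close>
  changes the weighted sum by the product of the two differences.\<close>
lemma maximal_permutation_sorts:
  fixes w x :: "nat \<Rightarrow> real"
  assumes \<pi>: "\<pi> permutes {1..N}" and p: "p \<in> {2..N}" and w: "w (p - 1) < w p"
    and max: "\<And>\<sigma>. \<sigma> permutes {1..N} \<Longrightarrow> (\<Sum>k=1..N. w k * x (\<sigma> k)) \<le> (\<Sum>k=1..N. w k * x (\<pi> k))"
  shows "x (\<pi> (p - 1)) \<le> x (\<pi> p)"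
proof -
  define \<sigma> where "\<sigma> = \<pi> \<circ> transpose (p - 1) p"
  have "\<sigma> permutes {1..N}" unfolding \<sigma>_def
    using p by (intro permutes_compose permutes_swap_id \<pi>) auto
  have "(\<Sum>k=1..N. w k * x (\<pi> k)) - (\<Sum>k=1..N. w k * x (\<sigma> k)) = (\<Sum>k=1..N. w k * (x (\<pi> k) - x (\<sigma> k)))"
    by (simp add: sum_subtractf algebra_simps)
  also have "\<dots> = (\<Sum>k\<in>{p - 1, p}. w k * (x (\<pi> k) - x (\<sigma> k)))"
    using p by (intro sum.mono_neutral_right) (auto simp: \<sigma>_def transpose_def)
  also have "\<dots> = (w p - w (p - 1)) * (x (\<pi> p) - x (\<pi> (p - 1)))"
    using p by (auto simp: \<sigma>_def algebra_simps)
  finally have "0 \<le> (w p - w (p - 1)) * (x (\<pi> p) - x (\<pi> (p - 1)))"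
    using max[OF \<open>\<sigma> permutes {1..N}\<close>] by simp
  then show ?thesis using w by (simp add: zero_le_mult_iff)
qed

section \<open>Ranked means on a strongly connected network\<close>

lemma diam_ge: "finite V \<Longrightarrow> i \<in> V \<Longrightarrow> j \<in> V \<Longrightarrow> z i - z j \<le> diam V z"
  unfolding diam_def by (intro diff_mono Max_ge Min_le) auto

lemma diam_attained:
  assumes "finite V" "V \<noteq> {}"
  obtains i j where "i \<in> V" "j \<in> V" "diam V z = z i - z j"
proof -
  have "Max (z ` V) \<in> z ` V" "Min (z ` V) \<in> z ` V" using assms by (auto intro!: Max_in Min_in)
  then show ?thesis using that by (auto simp: diam_def)
qed

lemma diam_le:
  assumes "finite V" "V \<noteq> {}" "\<And>i j. i \<in> V \<Longrightarrow> j \<in> V \<Longrightarrow> z i - z j \<le> b"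
  shows "diam V z \<le> b"
  using diam_attained[OF assms(1,2), of z] assms(3) by metis

lemma diam_nonneg: "finite V \<Longrightarrow> V \<noteq> {} \<Longrightarrow> 0 \<le> diam V z"
  using diam_ge[of V _ _ z] by fastforce

lemma abs_diff_le_diam: "finite V \<Longrightarrow> i \<in> V \<Longrightarrow> j \<in> V \<Longrightarrow> \<bar>z i - z j\<bar> \<le> diam V z"
  using diam_ge[of V i j z] diam_ge[of V j i z] by linarith

text \<open>The assumption \<open>cut\<close> is strong connectivity in the form in which it is used: every proper
  nonempty set of vertices is influenced from outside.\<close>
locale influence_network =
  fixes N :: nat and nb :: "nat \<Rightarrow> nat set" and c :: real
  assumes N: "N \<ge> 2" and c: "c > 1"
    and nb: "i \<in> {1..N} \<Longrightarrow> nb i \<subseteq> {1..N}"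
    and cut: "S \<subset> {1..N} \<Longrightarrow> S \<noteq> {} \<Longrightarrow> \<exists>i\<in>S. \<exists>j\<in>nb i. j \<notin> S"
begin

abbreviation "D \<equiv> diam {1..N}"

lemma V: "finite {1..N}" "{1..N} \<noteq> {}" using N by auto

lemmas D_ge = diam_ge[OF V(1)] and D_le = diam_le[OF V] and D_nonneg = diam_nonneg[OF V]
  and D_attained = diam_attained[OF V] and abs_diff_le_D = abs_diff_le_diam[OF V(1)]

lemma card_nb: "i \<in> {1..N} \<Longrightarrow> card (nb i) \<le> N"
  using card_mono[OF _ nb] by fastforce

text \<open>The least normalised weight. Times the diameter, it bounds from below the speed, per unit of
  coupling, at which each of the two extreme weighted means moves towards the other.\<close>
definition mu :: real where "mu = 1 / (1 + c) ^ (N - 1)"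

definition weight :: "nat \<Rightarrow> real" where "weight k = mu * cascade_weight c k"

definition ranked_mean :: "(nat \<Rightarrow> nat) \<Rightarrow> (nat \<Rightarrow> real) \<Rightarrow> real" where
  "ranked_mean \<pi> x = (\<Sum>k=1..N. weight k * x (\<pi> k))"

lemma mu_pos: "mu > 0" using c by (simp add: mu_def)

lemma weight_nonneg: "weight k \<ge> 0"
  using mu_pos cascade_weight_pos[of c k] c by (simp add: weight_def)

lemma sum_weight: "(\<Sum>k=1..N. weight k) = 1"
  unfolding weight_def sum_distrib_left[symmetric]
  using N c sum_cascade_weight[of N c] by (simp add: mu_def)

lemma weight_strict_mono: "1 \<le> p \<Longrightarrow> p < q \<Longrightarrow> weight p < weight q"
  using mu_pos cascade_weight_strict_mono[OF c] by (simp add: weight_def)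

lemma weight_last: "weight N = c / (1 + c)"
proof -
  have "N - 1 = Suc (N - 2)" using N by simp
  then show ?thesis using N c unfolding weight_def mu_def cascade_weight_def by simp
qed

lemma ranked_mean_le:
  assumes "\<pi> permutes {1..N}" "\<And>i. i \<in> {1..N} \<Longrightarrow> x i \<le> b"
  shows "ranked_mean \<pi> x \<le> b"
proof -
  have "ranked_mean \<pi> x \<le> (\<Sum>k=1..N. weight k * b)"
    unfolding ranked_mean_def using assms weight_nonneg permutes_in_image[OF assms(1)]
    by (intro sum_mono mult_left_mono) auto
  then show ?thesis using sum_weight by (simp add: sum_distrib_right[symmetric])
qed

lemma ranked_mean_uminus: "ranked_mean \<pi> (\<lambda>i. - x i) = - ranked_mean \<pi> x"
  by (simp add: ranked_mean_def sum_negf)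

lemma ranked_mean_add: "ranked_mean \<pi> (\<lambda>i. x i + y i) = ranked_mean \<pi> x + ranked_mean \<pi> y"
  by (simp add: ranked_mean_def sum.distrib distrib_left)

lemma ranked_mean_scale: "ranked_mean \<pi> (\<lambda>i. b * x i) = b * ranked_mean \<pi> x"
  by (simp add: ranked_mean_def sum_distrib_left mult_ac)

lemma ranked_mean_diff_le_D:
  assumes "\<pi> permutes {1..N}" "\<tau> permutes {1..N}"
    and "\<And>i j. i \<in> {1..N} \<Longrightarrow> j \<in> {1..N} \<Longrightarrow> x i - x j \<le> b"
  shows "ranked_mean \<pi> x - ranked_mean \<tau> x \<le> b"
proof -
  have "- ranked_mean \<tau> x \<le> b - x i" if "i \<in> {1..N}" for i
    using ranked_mean_le[OF assms(2), of "\<lambda>j. - x j" "b - x i"] assms(3)[OF that]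
    by (simp add: ranked_mean_uminus algebra_simps)
  then have "ranked_mean \<pi> x \<le> b + ranked_mean \<tau> x"
    by (intro ranked_mean_le[OF assms(1)]) (simp add: algebra_simps)
  then show ?thesis by simp
qed

text \<open>The top position carries the share \<open>c / (1 + c)\<close> of the weight, so a ranked mean with node
  \<open>i\<close> on top stays close to \<open>x i\<close>.\<close>
lemma ranked_mean_top_ge:
  assumes i: "i \<in> {1..N}" and lo: "\<And>k. k \<in> {1..N} \<Longrightarrow> b \<le> x k"
  shows "c / (1 + c) * x i + b / (1 + c) \<le> ranked_mean (transpose N i) x"
proof -
  let ?\<pi> = "transpose N i"
  have perm: "?\<pi> permutes {1..N}" using i N by (intro permutes_swap_id) auto
  have split: "{1..N} = insert N {1..N-1}" using N by auto
  have "(\<Sum>k=1..N. weight k) = weight N + (\<Sum>k=1..N-1. weight k)"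
    unfolding split using N by (subst sum.insert) auto
  then have rest: "(\<Sum>k=1..N-1. weight k) = 1 / (1 + c)"
    using sum_weight weight_last c by (simp add: field_simps)
  have "b / (1 + c) = (\<Sum>k=1..N-1. weight k * b)"
    using rest by (simp add: sum_distrib_right[symmetric])
  also have "\<dots> \<le> (\<Sum>k=1..N-1. weight k * x (?\<pi> k))"
    using weight_nonneg lo permutes_in_image[OF perm] by (intro sum_mono mult_left_mono) auto
  also have "weight N * x i + \<dots> = ranked_mean ?\<pi> x"
    unfolding ranked_mean_def split using N by (subst sum.insert) auto
  finally show ?thesis using weight_last by simp
qed

text \<open>The ranked means thus control the diameter with the loss factor
  \<open>c / (1 + c) - 1 / (1 + c)\<close>. This is what makes their spread a substitute for the diameter, which
  by itself need not decrease: the extreme vertices may have neighbours only at the same extreme.\<close>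
lemma D_le_ranked_spread:
  assumes "\<And>\<pi> \<tau>. \<pi> permutes {1..N} \<Longrightarrow> \<tau> permutes {1..N} \<Longrightarrow> ranked_mean \<pi> x - ranked_mean \<tau> x \<le> b"
  shows "(c - 1) / (c + 1) * D x \<le> b"
proof -
  obtain i j where ij: "i \<in> {1..N}" "j \<in> {1..N}" "D x = x i - x j" by (rule D_attained)
  have perm: "transpose N i permutes {1..N}" "transpose N j permutes {1..N}"
    using ij N by (auto intro!: permutes_swap_id)
  have "x j \<le> x k" "x k \<le> x i" if "k \<in> {1..N}" for k
    using D_ge[OF ij(1) that, of x] D_ge[OF that ij(2), of x] ij(3) by simp_all
  then have "c / (1 + c) * x i + x j / (1 + c) \<le> ranked_mean (transpose N i) x"
    and "c / (1 + c) * (- x j) + (- x i) / (1 + c) \<le> ranked_mean (transpose N j) (\<lambda>k. - x k)"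
    using ranked_mean_top_ge[OF ij(1), of "x j" x] ranked_mean_top_ge[OF ij(2), of "- x i" "\<lambda>k. - x k"]
    by simp_all
  moreover have "(c - 1) / (c + 1) * (x i - x j)
      = c / (1 + c) * x i + x j / (1 + c) + (c / (1 + c) * (- x j) + (- x i) / (1 + c))"
    using c by (simp add: divide_simps) (simp add: algebra_simps)
  ultimately show ?thesis using assms[OF perm] ij(3) by (simp add: ranked_mean_uminus)
qed

text \<open>A maximising permutation sorts the values, so \<open>sorted_cascade_dissipation\<close> applies after the nodes
  have been renamed by their positions. The set of nodes at positions \<open>p\<close> and above is influenced
  from outside, which supplies the arc that crosses the gap at \<open>p\<close>.\<close>
lemma top_mean_dissipation:
  fixes r :: "nat \<Rightarrow> nat \<Rightarrow> real"
  assumes \<pi>: "\<pi> permutes {1..N}"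
    and max: "\<And>\<sigma>. \<sigma> permutes {1..N} \<Longrightarrow> ranked_mean \<sigma> x \<le> ranked_mean \<pi> x"
    and s: "0 \<le> s" "real N \<le> s * c"
    and r: "\<And>i j. i \<in> {1..N} \<Longrightarrow> j \<in> nb i \<Longrightarrow> s \<le> r i j \<and> r i j \<le> 1"
  shows "ranked_mean \<pi> (\<lambda>i. \<Sum>j\<in>nb i. r i j * (x j - x i)) \<le> - mu * D x"
proof -
  define y where "y k = x (\<pi> k)" for k
  define B where "B k = inv \<pi> ` nb (\<pi> k)" for k
  have inv: "\<pi> (inv \<pi> l) = l" "inv \<pi> (\<pi> l) = l" for l using permutes_inverses[OF \<pi>] by auto
  have in_V: "\<pi> k \<in> {1..N}" if "k \<in> {1..N}" for k using permutes_in_image[OF \<pi>] that by blast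
  have sorted1: "y (p - 1) \<le> y p" if "p \<in> {2..N}" for p
    unfolding y_def using that max
    by (intro maximal_permutation_sorts[OF \<pi> that, of weight] weight_strict_mono) (auto simp: ranked_mean_def)
  have sorted: "y p \<le> y q" if "p \<le> q" "1 \<le> p" "q \<le> N" for p q
    using that
  proof (induction q rule: dec_induct)
    case (step n)
    then show ?case using sorted1[of "Suc n"] by simp
  qed simp
  have "D x \<le> y N - y 1"
  proof (rule D_le)
    fix i j assume ij: "i \<in> {1..N}" "j \<in> {1..N}"
    have "inv \<pi> i \<in> {1..N}" "inv \<pi> j \<in> {1..N}" using permutes_in_image[OF permutes_inv[OF \<pi>]] ij by blast+
    then have "y (inv \<pi> i) \<le> y N" "y 1 \<le> y (inv \<pi> j)" by (auto intro!: sorted)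
    then show "x i - x j \<le> y N - y 1" by (simp add: y_def inv)
  qed
  moreover have "(\<Sum>k=1..N. cascade_weight c k * (\<Sum>l\<in>B k. r (\<pi> k) (\<pi> l) * (y l - y k))) \<le> - (y N - y 1)"
  proof (rule sorted_cascade_dissipation[OF _ c s])
    fix p assume "p \<in> {2..N}"
    then show "y (p - 1) \<le> y p" by (rule sorted1)
  next
    fix k assume "k \<in> {1..N}"
    from nb[OF in_V[OF this]] show "B k \<subseteq> {1..N}"
      unfolding B_def using permutes_in_image[OF permutes_inv[OF \<pi>]] by blast
  next
    fix p assume p: "p \<in> {2..N}"
    have "\<pi> ` {p..N} \<subseteq> {1..N}" using in_V p by auto
    moreover have "\<pi> 1 \<in> {1..N}" "\<pi> 1 \<notin> \<pi> ` {p..N}" using in_V[of 1] p inj_eq[OF permutes_inj[OF \<pi>]] by auto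
    ultimately obtain i j where "i \<in> \<pi> ` {p..N}" "j \<in> nb i" "j \<notin> \<pi> ` {p..N}"
      using cut[of "\<pi> ` {p..N}"] p by (metis atLeastAtMost_iff atLeastatMost_empty_iff2 image_is_empty not_le psubsetI)
    then obtain k where k: "k \<in> {p..N}" "j \<in> nb (\<pi> k)" "j \<notin> \<pi> ` {p..N}" by auto
    have "j \<in> {1..N}" using nb[OF in_V[of k]] k p by auto
    then have "inv \<pi> j \<in> {1..N}" using permutes_in_image[OF permutes_inv[OF \<pi>]] by blast
    moreover have "inv \<pi> j \<notin> {p..N}" using k(3) inv(1)[of j] by (metis imageI)
    ultimately have "inv \<pi> j < p" by auto
    moreover have "inv \<pi> j \<in> B k" using k by (auto simp: B_def)
    ultimately show "\<exists>k\<in>{p..N}. \<exists>l\<in>B k. l < p" using k(1) by blast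
  next
    fix k l assume "k \<in> {1..N}" "l \<in> B k"
    then show "s \<le> r (\<pi> k) (\<pi> l) \<and> r (\<pi> k) (\<pi> l) \<le> 1"
      by (intro r in_V) (auto simp: B_def inv)
  qed (use N in auto)
  moreover have "(\<Sum>l\<in>B k. r (\<pi> k) (\<pi> l) * (y l - y k)) = (\<Sum>j\<in>nb (\<pi> k). r (\<pi> k) j * (x j - x (\<pi> k)))" for k
    unfolding B_def y_def
    by (subst sum.reindex) (auto simp: inv intro!: inj_on_subset[OF permutes_inj[OF permutes_inv[OF \<pi>]]])
  moreover have "ranked_mean \<pi> (\<lambda>i. \<Sum>j\<in>nb i. r i j * (x j - x i))
      = mu * (\<Sum>k=1..N. cascade_weight c k * (\<Sum>j\<in>nb (\<pi> k). r (\<pi> k) j * (x j - x (\<pi> k))))"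
    by (simp add: ranked_mean_def weight_def sum_distrib_left mult_ac)
  ultimately show ?thesis
    using mult_left_mono[OF _ less_imp_le[OF mu_pos], of _ "- D x"] by simp
qed

section \<open>Dissipation for a coupling with lag\<close>

text \<open>The state \<open>x\<close> moves with velocity \<open>f\<close>, while the coupling acts through the physical variable
  \<open>x - v\<close>. The coupling is expressed through differences of \<open>x\<close> with coefficients in
  \<open>[s, 1]\<close>; the lag \<open>v\<close> enters as an error \<open>d\<close>. The terms \<open>h\<close> collect the
  heterogeneous drive. Both the phases and the frequencies of the oscillators fit this form.\<close>
definition lagged_coupling ::
    "real \<Rightarrow> real \<Rightarrow> real \<Rightarrow> (nat \<Rightarrow> real) \<Rightarrow> (nat \<Rightarrow> real) \<Rightarrow> (nat \<Rightarrow> real) \<Rightarrow> bool" where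
  "lagged_coupling \<kappa> s P x v f \<longleftrightarrow>
     (\<exists>r d h. (\<forall>i\<in>{1..N}. f i = h i + \<kappa> * (\<Sum>j\<in>nb i. r i j * (x j - x i) + d i j)) \<and>
              (\<forall>i\<in>{1..N}. \<forall>j\<in>nb i. s \<le> r i j \<and> r i j \<le> 1 \<and> \<bar>d i j\<bar> \<le> D v) \<and>
              (\<forall>i\<in>{1..N}. \<forall>j\<in>{1..N}. h i - h j \<le> P))"

text \<open>The maximum of these functions over all indices is the Lyapunov functional: the largest ranked mean
  of \<open>x\<close> minus the smallest one, plus \<open>\<beta>\<close> times the diameter of the lag. Keeping the members of
  the family apart makes each of them differentiable in time.\<close>
definition spread_energy ::
    "real \<Rightarrow> (nat \<Rightarrow> nat) \<times> (nat \<Rightarrow> nat) \<times> nat \<times> nat \<Rightarrow> (nat \<Rightarrow> real) \<Rightarrow> (nat \<Rightarrow> real) \<Rightarrow> real" where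
  "spread_energy \<beta> = (\<lambda>(\<pi>, \<tau>, i, j) x v. ranked_mean \<pi> x - ranked_mean \<tau> x + \<beta> * (v i - v j))"

definition energy_indices :: "((nat \<Rightarrow> nat) \<times> (nat \<Rightarrow> nat) \<times> nat \<times> nat) set" where
  "energy_indices = {\<pi>. \<pi> permutes {1..N}} \<times> {\<tau>. \<tau> permutes {1..N}} \<times> {1..N} \<times> {1..N}"

lemma finite_energy_indices: "finite energy_indices"
  unfolding energy_indices_def by (intro finite_cartesian_product finite_permutations) auto

text \<open>The dissipation \<open>2 * \<kappa> * mu\<close> of the two ranked means, reduced by what the lag feeds back.\<close>
definition rate :: "real \<Rightarrow> real \<Rightarrow> real" where
  "rate \<kappa> m = 2 * \<kappa> * mu - 8 * (real N)\<^sup>2 * \<kappa>\<^sup>2 * m"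

lemma abs_coupling_sum_le:
  assumes "i \<in> {1..N}" "\<And>j. j \<in> nb i \<Longrightarrow> \<bar>q j\<bar> \<le> b" "0 \<le> b"
  shows "\<bar>\<Sum>j\<in>nb i. q j\<bar> \<le> real N * b"
proof -
  have "\<bar>\<Sum>j\<in>nb i. q j\<bar> \<le> (\<Sum>j\<in>nb i. b)" using assms(2) by (rule order.trans[OF sum_abs sum_mono])
  also have "\<dots> = real (card (nb i)) * b" by simp
  also have "\<dots> \<le> real N * b" using card_nb[OF assms(1)] assms(3) by (intro mult_right_mono) auto
  finally show ?thesis .
qed

text \<open>The top and the bottom ranked mean close in at rate \<open>2 * \<kappa> * mu * D x\<close>, up to an error
  \<open>2 * N * \<kappa> * D v\<close> caused by the lag. The lag relaxes at rate \<open>1 / m\<close> and is driven by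
  differences of \<open>f\<close>, which are at most \<open>P + 2 * N * \<kappa> * (D x + D v)\<close>. The choice
  \<open>\<beta> = 4 * N * \<kappa> * m\<close> makes the relaxation \<open>\<beta> * D v / m\<close> twice the error, and for small
  inertia the remaining half absorbs the other terms in \<open>D v\<close> and still leaves decay at the
  rate of the whole energy.\<close>
lemma spread_energy_dissipation:
  assumes \<kappa>: "\<kappa> > 0" and m: "m > 0" and small: "8 * (real N)\<^sup>2 * \<kappa> * m \<le> 1" "rate \<kappa> m \<ge> 0"
    and s: "0 \<le> s" "real N \<le> s * c" and f: "lagged_coupling \<kappa> s P x v f"
    and \<beta>: "\<beta> = 4 * real N * \<kappa> * m"
    and k: "k \<in> energy_indices"
    and max: "\<And>l. l \<in> energy_indices \<Longrightarrow> spread_energy \<beta> l x v \<le> spread_energy \<beta> k x v"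
  shows "spread_energy \<beta> k f (\<lambda>i. f i - v i / m) \<le> (1 + \<beta>) * P - rate \<kappa> m * spread_energy \<beta> k x v"
proof -
  obtain \<pi> \<tau> i j where k_eq: "k = (\<pi>, \<tau>, i, j)" by (cases k)
  have \<pi>: "\<pi> permutes {1..N}" and \<tau>: "\<tau> permutes {1..N}" and i: "i \<in> {1..N}" and j: "j \<in> {1..N}"
    using k by (auto simp: energy_indices_def k_eq)
  have idx: "(\<pi>', \<tau>', i', j') \<in> energy_indices" if "\<pi>' permutes {1..N}" "\<tau>' permutes {1..N}" "i' \<in> {1..N}" "j' \<in> {1..N}" for \<pi>' \<tau>' i' j'
    using that by (auto simp: energy_indices_def)
  have \<beta>pos: "\<beta> > 0" using \<beta> \<kappa> m N by simp
  have max_\<pi>: "ranked_mean \<sigma> x \<le> ranked_mean \<pi> x" if "\<sigma> permutes {1..N}" for \<sigma>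
    using max[OF idx[OF that \<tau> i j]] by (simp add: spread_energy_def k_eq)
  have max_\<tau>: "ranked_mean \<tau> x \<le> ranked_mean \<sigma> x" if "\<sigma> permutes {1..N}" for \<sigma>
    using max[OF idx[OF \<pi> that i j]] by (simp add: spread_energy_def k_eq)
  have "v i' - v j' \<le> v i - v j" if "i' \<in> {1..N}" "j' \<in> {1..N}" for i' j'
    using max[OF idx[OF \<pi> \<tau> that]] \<beta>pos by (simp add: spread_energy_def k_eq)
  then have Dv: "v i - v j = D v" using D_ge[OF i j, of v] D_le[of v "v i - v j"] by simp
  obtain r d h where f_eq: "\<And>i. i \<in> {1..N} \<Longrightarrow> f i = h i + \<kappa> * (\<Sum>j\<in>nb i. r i j * (x j - x i) + d i j)"
    and r: "\<And>i j. i \<in> {1..N} \<Longrightarrow> j \<in> nb i \<Longrightarrow> s \<le> r i j \<and> r i j \<le> 1"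
    and d: "\<And>i j. i \<in> {1..N} \<Longrightarrow> j \<in> nb i \<Longrightarrow> \<bar>d i j\<bar> \<le> D v"
    and h: "\<And>i j. i \<in> {1..N} \<Longrightarrow> j \<in> {1..N} \<Longrightarrow> h i - h j \<le> P"
    using f unfolding lagged_coupling_def by fast
  define R where "R i = (\<Sum>j\<in>nb i. r i j * (x j - x i))" for i
  define E where "E i = (\<Sum>j\<in>nb i. d i j)" for i
  have f_split: "f i = h i + \<kappa> * (R i + E i)" if "i \<in> {1..N}" for i
    using f_eq[OF that] by (simp add: R_def E_def sum.distrib)
  have E: "\<bar>E i\<bar> \<le> real N * D v" if "i \<in> {1..N}" for i
    unfolding E_def using that d D_nonneg by (intro abs_coupling_sum_le)
  have R: "\<bar>R i\<bar> \<le> real N * D x" if "i \<in> {1..N}" for i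
    unfolding R_def
  proof (intro abs_coupling_sum_le that D_nonneg)
    fix j assume j: "j \<in> nb i"
    have "\<bar>r i j\<bar> * \<bar>x j - x i\<bar> \<le> 1 * D x"
      using r[OF that j] s nb[OF that] j that D_nonneg[of x]
      by (intro mult_mono abs_diff_le_D) auto
    then show "\<bar>r i j * (x j - x i)\<bar> \<le> D x" by (simp add: abs_mult)
  qed
  have mean_f: "ranked_mean \<sigma> f = ranked_mean \<sigma> h + \<kappa> * (ranked_mean \<sigma> R + ranked_mean \<sigma> E)"
    if "\<sigma> permutes {1..N}" for \<sigma>
  proof -
    have "ranked_mean \<sigma> f = ranked_mean \<sigma> (\<lambda>i. h i + \<kappa> * (R i + E i))"
      unfolding ranked_mean_def using f_split permutes_in_image[OF that] by (intro sum.cong) auto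
    then show ?thesis by (simp add: ranked_mean_add ranked_mean_scale)
  qed
  have top: "ranked_mean \<pi> R \<le> - mu * D x"
    unfolding R_def by (intro top_mean_dissipation[OF \<pi> max_\<pi> s r])
  have "ranked_mean \<tau> (\<lambda>i. \<Sum>j\<in>nb i. r i j * (- x j - - x i)) \<le> - mu * D (\<lambda>i. - x i)"
    by (intro top_mean_dissipation[OF \<tau> _ s r]) (auto simp: ranked_mean_uminus max_\<tau>)
  moreover have "(\<lambda>i. \<Sum>j\<in>nb i. r i j * (- x j - - x i)) = (\<lambda>i. - R i)"
    by (simp add: R_def fun_eq_iff sum_negf[symmetric] algebra_simps)
  moreover have "D x \<le> D (\<lambda>i. - x i)"
  proof (rule D_le)
    fix i j assume "i \<in> {1..N}" "j \<in> {1..N}"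
    then show "x i - x j \<le> D (\<lambda>i. - x i)" using D_ge[of j i "\<lambda>i. - x i"] by simp
  qed
  ultimately have bottom: "mu * D x \<le> ranked_mean \<tau> R"
    using mult_left_mono[OF _ less_imp_le[OF mu_pos], of "D x" "D (\<lambda>i. - x i)"]
    by (simp add: ranked_mean_uminus)
  have E_spread: "ranked_mean \<pi> E - ranked_mean \<tau> E \<le> 2 * (real N * D v)"
  proof (rule ranked_mean_diff_le_D[OF \<pi> \<tau>])
    fix i j assume "i \<in> {1..N}" "j \<in> {1..N}"
    then show "E i - E j \<le> 2 * (real N * D v)" using E[of i] E[of j] by linarith
  qed
  have "ranked_mean \<pi> f - ranked_mean \<tau> f
      = (ranked_mean \<pi> h - ranked_mean \<tau> h) + \<kappa> * ((ranked_mean \<pi> R - ranked_mean \<tau> R) + (ranked_mean \<pi> E - ranked_mean \<tau> E))"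
    using mean_f[OF \<pi>] mean_f[OF \<tau>] by (simp add: algebra_simps)
  also have "\<dots> \<le> P + \<kappa> * (- 2 * mu * D x + 2 * (real N * D v))"
    using ranked_mean_diff_le_D[OF \<pi> \<tau> h] top bottom E_spread \<kappa>
    by (intro add_mono mult_left_mono) auto
  finally have x_part: "ranked_mean \<pi> f - ranked_mean \<tau> f \<le> P + \<kappa> * (- 2 * mu * D x + 2 * (real N * D v))" .
  have "f i - f j = (h i - h j) + \<kappa> * ((R i - R j) + (E i - E j))"
    using f_split i j by (simp add: algebra_simps)
  also have "\<dots> \<le> P + \<kappa> * (2 * (real N * D x) + 2 * (real N * D v))"
  proof (intro add_mono mult_left_mono)
    show "R i - R j \<le> 2 * (real N * D x)" using R[OF i] R[OF j] by linarith
    show "E i - E j \<le> 2 * (real N * D v)" using E[OF i] E[OF j] by linarith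
  qed (use h i j \<kappa> in auto)
  finally have "\<beta> * ((f i - v i / m) - (f j - v j / m))
      \<le> \<beta> * (P + \<kappa> * (2 * (real N * D x) + 2 * (real N * D v)) - D v / m)"
  proof (intro mult_left_mono)
    have "v i / m - v j / m = D v / m" using Dv by (metis diff_divide_distrib)
    then show "(f i - v i / m) - (f j - v j / m) \<le> P + \<kappa> * (2 * (real N * D x) + 2 * (real N * D v)) - D v / m"
      if "f i - f j \<le> P + \<kappa> * (2 * (real N * D x) + 2 * (real N * D v))"
      using that by linarith
  qed (use \<beta>pos in simp)
  also have "\<dots> = \<beta> * P + 8 * (real N)\<^sup>2 * \<kappa>\<^sup>2 * m * D x + 8 * (real N)\<^sup>2 * \<kappa>\<^sup>2 * m * D v - 4 * real N * \<kappa> * D v"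
    using m by (simp add: \<beta> field_simps power2_eq_square)
  finally have v_part: "\<beta> * ((f i - v i / m) - (f j - v j / m)) \<le> \<dots>" .
  have "spread_energy \<beta> k f (\<lambda>i. f i - v i / m)
      = (ranked_mean \<pi> f - ranked_mean \<tau> f) + \<beta> * ((f i - v i / m) - (f j - v j / m))"
    by (simp add: spread_energy_def k_eq)
  also have "\<dots> \<le> (1 + \<beta>) * P - rate \<kappa> m * D x - (2 * real N * \<kappa> - 8 * (real N)\<^sup>2 * \<kappa>\<^sup>2 * m) * D v"
    using x_part v_part by (simp add: rate_def algebra_simps)
  also have "\<dots> \<le> (1 + \<beta>) * P - rate \<kappa> m * D x - rate \<kappa> m * \<beta> * D v"
  proof -
    have "mu \<le> 1" using c by (simp add: mu_def)
    then have "2 * \<kappa> * mu \<le> 2 * \<kappa> * 1" using \<kappa> by (intro mult_left_mono) auto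
    moreover have "0 \<le> 8 * (real N)\<^sup>2 * \<kappa>\<^sup>2 * m" using m by simp
    ultimately have "rate \<kappa> m \<le> 2 * \<kappa>" unfolding rate_def by linarith
    then have "rate \<kappa> m * \<beta> \<le> 2 * \<kappa> * \<beta>" using \<beta>pos by (intro mult_right_mono) auto
    also have "\<dots> = \<kappa> * (8 * real N * \<kappa> * m)" by (simp add: \<beta>)
    also have "\<dots> \<le> \<kappa> * (2 * real N - 8 * (real N)\<^sup>2 * \<kappa> * m)"
    proof (intro mult_left_mono)
      have "8 * real N * \<kappa> * m = 8 * (real N * 1) * \<kappa> * m" by simp
      also have "\<dots> \<le> 8 * (real N * real N) * \<kappa> * m"
        using N \<kappa> m by (intro mult_right_mono mult_left_mono) auto
      also have "\<dots> \<le> 1" using small(1) by (simp add: power2_eq_square)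
      finally show "8 * real N * \<kappa> * m \<le> 2 * real N - 8 * (real N)\<^sup>2 * \<kappa> * m" using small(1) N by simp
    qed (use \<kappa> in simp)
    also have "\<dots> = 2 * real N * \<kappa> - 8 * (real N)\<^sup>2 * \<kappa>\<^sup>2 * m" by (simp add: algebra_simps power2_eq_square)
    finally show ?thesis using D_nonneg[of v] by (simp add: mult_right_mono)
  qed
  also have "\<dots> \<le> (1 + \<beta>) * P - rate \<kappa> m * spread_energy \<beta> k x v"
  proof -
    have "spread_energy \<beta> k x v \<le> D x + \<beta> * D v"
      using ranked_mean_diff_le_D[OF \<pi> \<tau>, of x "D x"] D_ge Dv by (simp add: spread_energy_def k_eq)
    from mult_left_mono[OF this small(2)] show ?thesis by (simp add: algebra_simps)
  qed
  finally show ?thesis .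
qed

text \<open>The coupling condition \<open>f\<close> is required only where the diameter of \<open>x\<close> respects the bound that
  the barrier implies. The lemma therefore serves as a continuation argument: the bound that makes the
  coupling dissipative is itself preserved.\<close>
lemma spread_energy_below_barrier:
  fixes x v f :: "nat \<Rightarrow> real \<Rightarrow> real" and L L' :: "real \<Rightarrow> real"
  assumes \<kappa>: "\<kappa> > 0" and m: "m > 0" and small: "8 * (real N)\<^sup>2 * \<kappa> * m \<le> 1" "rate \<kappa> m \<ge> 0"
    and s: "0 \<le> s" "real N \<le> s * c" and \<beta>: "\<beta> = 4 * real N * \<kappa> * m"
    and cont: "\<And>i. i \<in> {1..N} \<Longrightarrow> continuous_on {start..} (x i)" "\<And>i. i \<in> {1..N} \<Longrightarrow> continuous_on {start..} (v i)"
    and der: "\<And>i t. i \<in> {1..N} \<Longrightarrow> t > start \<Longrightarrow> (x i has_real_derivative f i t) (at t)"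
      "\<And>i t. i \<in> {1..N} \<Longrightarrow> t > start \<Longrightarrow> (v i has_real_derivative f i t - v i t / m) (at t)"
    and contL: "continuous_on {start..} L"
    and derL: "\<And>t. t > start \<Longrightarrow> (L has_real_derivative L' t) (at t)"
    and L': "\<And>t. t > start \<Longrightarrow> (1 + \<beta>) * P - rate \<kappa> m * L t < L' t"
    and init: "D (\<lambda>i. x i start) + \<beta> * D (\<lambda>i. v i start) < L start"
    and f: "\<And>t. t > start \<Longrightarrow> D (\<lambda>i. x i t) \<le> (c + 1) / (c - 1) * L t \<Longrightarrow>
              lagged_coupling \<kappa> s P (\<lambda>i. x i t) (\<lambda>i. v i t) (\<lambda>i. f i t)"
    and t: "t \<ge> start"
  shows "D (\<lambda>i. x i t) \<le> (c + 1) / (c - 1) * L t \<and> \<beta> * D (\<lambda>i. v i t) \<le> L t"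
proof
  have \<beta>pos: "\<beta> > 0" using \<beta> \<kappa> m N by simp
  have Dx: "D (\<lambda>i. x i t) \<le> (c + 1) / (c - 1) * L t"
    if "\<And>k. k \<in> energy_indices \<Longrightarrow> spread_energy \<beta> k (\<lambda>i. x i t) (\<lambda>i. v i t) \<le> L t" for t
  proof -
    have "(c - 1) / (c + 1) * D (\<lambda>i. x i t) \<le> L t"
    proof (rule D_le_ranked_spread)
      fix \<pi> \<tau> assume "\<pi> permutes {1..N}" "\<tau> permutes {1..N}"
      then have "(\<pi>, \<tau>, 1, 1) \<in> energy_indices" using N by (auto simp: energy_indices_def)
      from that[OF this] show "ranked_mean \<pi> (\<lambda>i. x i t) - ranked_mean \<tau> (\<lambda>i. x i t) \<le> L t"
        by (simp add: spread_energy_def)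
    qed
    then show ?thesis using c by (simp add: field_simps)
  qed
  have below: "spread_energy \<beta> k (\<lambda>i. x i t) (\<lambda>i. v i t) < L t" if k: "k \<in> energy_indices" for k
    using finite_energy_indices _ contL _ derL _ _ k t
  proof (rule finite_family_stays_below[where
        e = "\<lambda>k t. spread_energy \<beta> k (\<lambda>i. x i t) (\<lambda>i. v i t)" and
        e' = "\<lambda>k t. spread_energy \<beta> k (\<lambda>i. f i t) (\<lambda>i. f i t - v i t / m)"])
    fix k assume k: "k \<in> energy_indices"
    obtain \<pi> \<tau> i j where k_eq: "k = (\<pi>, \<tau>, i, j)" by (cases k)
    have kk: "\<pi> permutes {1..N}" "\<tau> permutes {1..N}" "i \<in> {1..N}" "j \<in> {1..N}"
      using k by (auto simp: energy_indices_def k_eq)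
    have img: "\<pi> l \<in> {1..N}" "\<tau> l \<in> {1..N}" if "l \<in> {1..N}" for l
      using permutes_in_image[OF kk(1)] permutes_in_image[OF kk(2)] that by blast+
    show "continuous_on {start..} (\<lambda>t. spread_energy \<beta> k (\<lambda>i. x i t) (\<lambda>i. v i t))"
      unfolding k_eq spread_energy_def ranked_mean_def prod.case
      by (intro continuous_intros cont kk img)
    show "((\<lambda>t. spread_energy \<beta> k (\<lambda>i. x i t) (\<lambda>i. v i t)) has_real_derivative
        spread_energy \<beta> k (\<lambda>i. f i t) (\<lambda>i. f i t - v i t / m)) (at t)" if "t > start" for t
      unfolding k_eq spread_energy_def ranked_mean_def prod.case
      by (intro DERIV_add DERIV_diff DERIV_sum DERIV_cmult der kk img that)
    have "spread_energy \<beta> k (\<lambda>i. x i start) (\<lambda>i. v i start) \<le> D (\<lambda>i. x i start) + \<beta> * D (\<lambda>i. v i start)"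
      unfolding k_eq spread_energy_def prod.case
      using \<beta>pos by (intro add_mono mult_left_mono ranked_mean_diff_le_D D_ge kk) auto
    then show "spread_energy \<beta> k (\<lambda>i. x i start) (\<lambda>i. v i start) < L start" using init by simp
    fix t assume t: "start < t"
      and le: "\<And>l. l \<in> energy_indices \<Longrightarrow> spread_energy \<beta> l (\<lambda>i. x i t) (\<lambda>i. v i t) \<le> L t"
      and eq: "spread_energy \<beta> k (\<lambda>i. x i t) (\<lambda>i. v i t) = L t"
    have "spread_energy \<beta> k (\<lambda>i. f i t) (\<lambda>i. f i t - v i t / m)
        \<le> (1 + \<beta>) * P - rate \<kappa> m * spread_energy \<beta> k (\<lambda>i. x i t) (\<lambda>i. v i t)"
      using le eq by (intro spread_energy_dissipation[OF \<kappa> m small s f[OF t Dx] \<beta> k]) auto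
    then show "spread_energy \<beta> k (\<lambda>i. f i t) (\<lambda>i. f i t - v i t / m) < L' t"
      using L'[OF t] eq by simp
  qed
  show "D (\<lambda>i. x i t) \<le> (c + 1) / (c - 1) * L t" using below by (intro Dx less_imp_le)
  obtain i j where ij: "i \<in> {1..N}" "j \<in> {1..N}" "D (\<lambda>i. v i t) = v i t - v j t" by (rule D_attained)
  then have "(id, id, i, j) \<in> energy_indices" by (auto simp: energy_indices_def permutes_id)
  from below[OF this] show "\<beta> * D (\<lambda>i. v i t) \<le> L t" by (simp only: spread_energy_def ij(3) prod.case)
qed

end

section \<open>A lower bound for the rate\<close>

text \<open>Every factor but the first is at least \<open>1 + c\<close>, and the first one is \<open>c\<close>.\<close>
lemma power_le_rising_product:
  fixes c :: real
  assumes "c > 0" "N \<ge> 2"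
  shows "(1 + c) ^ (N - 1) * c \<le> (1 + c) * (\<Prod>i=0..N-2. c + real i)"
  using \<open>N \<ge> 2\<close>
proof (induction N rule: dec_induct)
  case base
  then show ?case by simp
next
  case (step n)
  have eq: "Suc n - 2 = Suc (n - 2)" "Suc n - 1 = Suc (n - 1)" using step by auto
  have "(1 + c) ^ (Suc n - 1) * c = (1 + c) * ((1 + c) ^ (n - 1) * c)"
    using step by (simp add: power_eq_if)
  also have "\<dots> \<le> (c + real (n - 1)) * ((1 + c) * (\<Prod>i=0..n-2. c + real i))"
    using step assms by (intro mult_mono[OF _ step.IH] mult_nonneg_nonneg) auto
  also have "\<dots> = (1 + c) * (\<Prod>i=0..Suc n - 2. c + real i)"
  proof -
    have "Suc (n - 2) = n - 1" using step by simp
    then show ?thesis unfolding eq by (subst prod.atLeast0_atMost_Suc) (simp add: mult_ac)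
  qed
  finally show ?case .
qed

context influence_network
begin

text \<open>Since \<open>mu \<ge> c / ((1 + c) * M)\<close>, the dissipation is about \<open>2 * \<kappa>' / M\<close>. The feedback of the
  lag costs at most \<open>(c - 2) / (c + 2)\<close> units of \<open>\<kappa>' / M\<close>, and
  \<open>2 * c / (c + 1) - (c - 2) / (c + 2) \<ge> 1\<close>.\<close>
lemma rate_ge:
  assumes c2: "c > 2" and M: "M = (\<Prod>i=0..N-2. c + real i)"
    and \<kappa>: "0 < \<kappa>'" "\<kappa>' \<le> \<kappa>" and m: "m > 0"
    and small: "8 * (real N)\<^sup>2 * \<kappa> * m \<le> (c - 2) / (c + 2) / M"
  shows "\<kappa>' / M \<le> rate \<kappa>' m"
proof -
  have Mpos: "M > 0" unfolding M using c by (intro prod_pos) (auto simp: add_pos_nonneg)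
  have "c / ((1 + c) * M) \<le> mu"
  proof (rule mult_imp_div_pos_le)
    have "c = mu * ((1 + c) ^ (N - 1) * c)" using c by (simp add: mu_def)
    also have "\<dots> \<le> mu * ((1 + c) * M)"
      using power_le_rising_product[of c N] c N mu_pos unfolding M by (intro mult_left_mono) auto
    finally show "c \<le> mu * ((1 + c) * M)" .
  qed (use c Mpos in simp)
  moreover have "8 * (real N)\<^sup>2 * \<kappa>' * m \<le> (c - 2) / (c + 2) / M"
  proof (rule order.trans[OF _ small])
    show "8 * (real N)\<^sup>2 * \<kappa>' * m \<le> 8 * (real N)\<^sup>2 * \<kappa> * m"
      using \<kappa> m by (intro mult_right_mono mult_left_mono) auto
  qed
  moreover have "1 / M \<le> 2 * (c / ((1 + c) * M)) - (c - 2) / (c + 2) / M"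
  proof -
    have "1 \<le> 2 * (c / (1 + c)) - (c - 2) / (c + 2)"
      using c2 by (simp add: divide_simps) (simp add: algebra_simps)
    from divide_right_mono[OF this less_imp_le[OF Mpos]] show ?thesis
      by (simp add: diff_divide_distrib)
  qed
  ultimately have "1 / M \<le> 2 * mu - 8 * (real N)\<^sup>2 * \<kappa>' * m" by linarith
  from mult_left_mono[OF this, of \<kappa>'] \<kappa> show ?thesis
    by (simp add: rate_def algebra_simps power2_eq_square)
qed

end

section \<open>Connectivity and elementary estimates\<close>

text \<open>A path from a vertex outside \<open>S\<close> to one inside must enter \<open>S\<close> through some arc.\<close>
lemma strongly_connected_cut:
  assumes conn: "strongly_connected (with_proj G)"
    and S: "S \<subset> pverts G" "S \<noteq> {}"
  shows "\<exists>i\<in>S. \<exists>j\<in>neighbors G i. j \<notin> S"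
proof (rule ccontr)
  assume closed: "\<not> ?thesis"
  obtain u v where u: "u \<in> pverts G" "u \<notin> S" and v: "v \<in> S" using S by blast
  have "u \<rightarrow>\<^sup>*\<^bsub>with_proj G\<^esub> v"
    using conn u v S by (auto elim!: strongly_connectedE)
  then have "(u, v) \<in> (parcs G)\<^sup>*" by (auto dest: reachable_rtranclI)
  then have "v \<notin> S"
    by (induction rule: rtrancl_induct) (use u closed in \<open>auto simp: neighbors_def\<close>)
  then show False using v by simp
qed

text \<open>By the mean value theorem \<open>sin z / z\<close> is the value of \<open>cos\<close> at a point below \<open>z\<close>, and the slope
  of \<open>sin\<close> between \<open>z\<close> and \<open>\<gamma>\<close> is its value at a point above; \<open>cos\<close> decreases on
  \<open>[0, pi]\<close>.\<close>
lemma sinc_antimono: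
  assumes "0 < z" "z \<le> \<gamma>" "\<gamma> < pi"
  shows "sin \<gamma> / \<gamma> \<le> sin z / z"
proof (cases "z = \<gamma>")
  case False
  then have "z < \<gamma>" using assms by simp
  obtain p where p: "0 < p" "p < z" "sin z - sin 0 = (z - 0) * cos p"
    using MVT2[of 0 z sin cos] assms by (auto intro: DERIV_sin)
  obtain q where q: "z < q" "q < \<gamma>" "sin \<gamma> - sin z = (\<gamma> - z) * cos q"
    using MVT2[of z \<gamma> sin cos] \<open>z < \<gamma>\<close> by (auto intro: DERIV_sin)
  have "cos q \<le> cos p" using p q assms by (intro cos_monotone_0_pi_le) auto
  then have "(\<gamma> - z) * cos q \<le> (\<gamma> - z) * cos p"
    using \<open>z < \<gamma>\<close> by (intro mult_left_mono) auto
  then have "sin \<gamma> \<le> sin z + (\<gamma> - z) * cos p" using q(3) by linarith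
  also have "cos p = sin z / z" using p(3) assms by simp
  also have "sin z + (\<gamma> - z) * (sin z / z) = \<gamma> * (sin z / z)"
    using assms by (simp add: field_simps)
  finally show ?thesis using assms by (simp add: field_simps)
qed simp

lemma abs_sin_diff_le: "\<bar>sin x - sin y\<bar> \<le> \<bar>x - y\<bar>" for x y :: real
proof -
  have "\<bar>sin x - sin y\<bar> = 2 * \<bar>sin ((x - y) / 2)\<bar> * \<bar>cos ((x + y) / 2)\<bar>"
    by (simp add: sin_diff_sin abs_mult)
  also have "\<dots> \<le> 2 * \<bar>(x - y) / 2\<bar> * 1"
    by (intro mult_mono abs_sin_x_le_abs_x) auto
  finally show ?thesis by simp
qed

text \<open>The witness comes from \<open>exp y \<ge> y\<close>: it suffices that \<open>A * (t - t0) \<ge> K / \<delta>\<close>.\<close>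
lemma exp_decay_eventually_le:
  fixes K A \<delta> t0 :: real
  assumes "A > 0" "\<delta> > 0" "K \<ge> 0"
  obtains T where "T \<ge> t0" "\<And>t. t \<ge> T \<Longrightarrow> K * exp (- A * (t - t0)) \<le> \<delta>"
proof
  show "t0 + K / (A * \<delta>) \<ge> t0" using assms by simp
  fix t assume "t0 + K / (A * \<delta>) \<le> t"
  then have "K / (A * \<delta>) \<le> t - t0" by simp
  then have "K \<le> \<delta> * (A * (t - t0))" using assms by (simp add: field_simps)
  also have "\<dots> \<le> \<delta> * exp (A * (t - t0))"
    using assms exp_ge_add_one_self[of "A * (t - t0)"] by (intro mult_left_mono) linarith+
  finally have "K * exp (- A * (t - t0)) \<le> \<delta> * exp (A * (t - t0)) * exp (- A * (t - t0))"
    by (intro mult_right_mono) auto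
  also have "\<dots> = \<delta>" by (simp add: exp_minus)
  finally show "K * exp (- A * (t - t0)) \<le> \<delta>" .
qed

text \<open>Here \<open>y\<close> is an exponentially weighted moving average of \<open>x\<close>, so its diameter relaxes to that
  of \<open>x\<close>. The barrier relaxes at the same rate to a level strictly between the two bounds.\<close>
lemma low_pass_spread_eventually_le:
  fixes x y :: "nat \<Rightarrow> real \<Rightarrow> real"
  assumes V: "finite V" "V \<noteq> {}" and m: "m > 0" and b: "b < b'"
    and cont: "\<And>i. i \<in> V \<Longrightarrow> continuous_on {t0..} (y i)"
    and der: "\<And>i t. i \<in> V \<Longrightarrow> t > t0 \<Longrightarrow> (y i has_real_derivative (x i t - y i t) / m) (at t)"
    and x: "\<And>t. t > t0 \<Longrightarrow> diam V (\<lambda>i. x i t) \<le> b"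
  obtains T where "T \<ge> t0" "\<And>t. t \<ge> T \<Longrightarrow> diam V (\<lambda>i. y i t) \<le> b'"
proof -
  define b'' where "b'' = (b + b') / 2"
  define K where "K = diam V (\<lambda>i. y i t0) + \<bar>b''\<bar> + 1"
  define L where "L t = b'' + K * exp (- (1 / m) * (t - t0))" for t
  have b'': "b < b''" "b'' < b'" using b by (auto simp: b''_def)
  have K: "K \<ge> 0" using diam_nonneg[OF V, of "\<lambda>i. y i t0"] by (simp add: K_def)
  define e where "e k t = y (fst k) t - y (snd k) t" for k :: "nat \<times> nat" and t
  have below: "y i t - y j t < L t" if "i \<in> V" "j \<in> V" "t \<ge> t0" for i j t
  proof -
    have "e (i, j) t < L t"
    proof (rule finite_family_stays_below[where K = "V \<times> V" and start = t0 and k = "(i, j)" and t = t and L = L and e = e and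
          e' = "\<lambda>k t. (x (fst k) t - y (fst k) t) / m - (x (snd k) t - y (snd k) t) / m" and
          L' = "\<lambda>t. - (K / m) * exp (- (1 / m) * (t - t0))"])
      fix k t assume "k \<in> V \<times> V" "t0 < t"
      then show "(e k has_real_derivative
          (x (fst k) t - y (fst k) t) / m - (x (snd k) t - y (snd k) t) / m) (at t)"
        unfolding e_def by (auto intro!: DERIV_diff der)
    next
      fix t
      show "(L has_real_derivative - (K / m) * exp (- (1 / m) * (t - t0))) (at t)"
        unfolding L_def using m by (auto intro!: derivative_eq_intros)
    next
      fix k assume "k \<in> V \<times> V"
      then have "y (fst k) t0 - y (snd k) t0 \<le> diam V (\<lambda>i. y i t0)"
        by (intro diam_ge[OF V(1)]) auto
      then show "e k t0 < L t0" by (simp add: e_def L_def K_def)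
    next
      fix k t assume k: "k \<in> V \<times> V" and t: "t0 < t"
        and eq: "e k t = L t"
      obtain i j where ij: "k = (i, j)" "i \<in> V" "j \<in> V" using k by auto
      have "x i t - x j t \<le> b" using diam_ge[OF V(1) ij(2,3), of "\<lambda>i. x i t"] x[OF t] by simp
      then have "(x i t - y i t) / m - (x j t - y j t) / m \<le> (b - L t) / m"
        using eq m by (simp add: e_def ij diff_divide_distrib[symmetric] divide_right_mono)
      also have "\<dots> < (b'' - L t) / m" using b'' m by (intro divide_strict_right_mono) auto
      also have "\<dots> = - (K / m) * exp (- (1 / m) * (t - t0))" by (simp add: L_def)
      finally show "(x (fst k) t - y (fst k) t) / m - (x (snd k) t - y (snd k) t) / m
          < - (K / m) * exp (- (1 / m) * (t - t0))" by (simp add: ij)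
    qed (use V m that cont in \<open>auto simp: L_def e_def[abs_def] intro!: continuous_intros\<close>)
    then show ?thesis by (simp add: e_def)
  qed
  obtain T where T: "T \<ge> t0" "\<And>t. t \<ge> T \<Longrightarrow> K * exp (- (1 / m) * (t - t0)) \<le> b' - b''"
    using exp_decay_eventually_le[of "1 / m" "b' - b''" K t0] m b'' K by (metis diff_gt_0_iff_gt zero_less_divide_1_iff)
  show ?thesis
  proof (rule that[OF T(1)])
    fix t assume t: "t \<ge> T"
    show "diam V (\<lambda>i. y i t) \<le> b'"
    proof (rule diam_le[OF V])
      fix i j assume "i \<in> V" "j \<in> V"
      then show "y i t - y j t \<le> b'" using below[of i j t] T(2)[OF t] T(1) t by (simp add: L_def)
    qed
  qed
qed

section \<open>Phases and frequencies of inertial oscillators\<close>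

locale inertial_kuramoto_network = influence_network +
  fixes m \<kappa> \<alpha> :: real and \<Omega> :: "nat \<Rightarrow> real" and \<theta> \<omega> a :: "nat \<Rightarrow> real \<Rightarrow> real"
  assumes m: "m > 0" and \<kappa>: "\<kappa> > 0" and \<alpha>: "0 < \<alpha>" "\<alpha> < pi / 2"
    and cont_\<theta>: "i \<in> {1..N} \<Longrightarrow> continuous_on {0..} (\<theta> i)"
    and cont_\<omega>: "i \<in> {1..N} \<Longrightarrow> continuous_on {0..} (\<omega> i)"
    and der_\<theta>: "i \<in> {1..N} \<Longrightarrow> t > 0 \<Longrightarrow> (\<theta> i has_real_derivative \<omega> i t) (at t)"
    and der_\<omega>: "i \<in> {1..N} \<Longrightarrow> t > 0 \<Longrightarrow> (\<omega> i has_real_derivative a i t) (at t)"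
    and newton: "i \<in> {1..N} \<Longrightarrow> t > 0 \<Longrightarrow>
       m * a i t + \<omega> i t = \<Omega> i + \<kappa> * (\<Sum>j\<in>nb i. sin (\<theta> j t - \<theta> i t + \<alpha>))"
begin

text \<open>The right-hand side along the solution. By the equation of motion it is the derivative of the slow
  phase \<open>\<theta> + m * \<omega>\<close>.\<close>
definition force :: "nat \<Rightarrow> real \<Rightarrow> real" where
  "force i t = \<Omega> i + \<kappa> * (\<Sum>j\<in>nb i. sin (\<theta> j t - \<theta> i t + \<alpha>))"

text \<open>A bound for the spread of all terms that do not vanish when the phases agree: the natural
  frequencies and the part of the coupling that the frustration makes even in the phase differences.\<close>
definition drive_spread :: real where
  "drive_spread = D \<Omega> + 2 * real N * \<kappa> * sin \<alpha>"

lemma cos_\<alpha>: "cos \<alpha> > 0" and sin_\<alpha>: "sin \<alpha> > 0"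
  using \<alpha> by (auto intro!: cos_gt_zero sin_gt_zero)

lemma force_split:
  "force i t = (\<Omega> i + \<kappa> * sin \<alpha> * (\<Sum>j\<in>nb i. cos (\<theta> j t - \<theta> i t)))
     + \<kappa> * cos \<alpha> * (\<Sum>j\<in>nb i. sin (\<theta> j t - \<theta> i t))"
  unfolding force_def sin_add
  by (simp add: sum.distrib sum_distrib_left sum_distrib_right distrib_left mult_ac)

lemma drive_diff_le:
  assumes ij: "i \<in> {1..N}" "j \<in> {1..N}"
  shows "(\<Omega> i + \<kappa> * sin \<alpha> * (\<Sum>k\<in>nb i. cos (\<theta> k t - \<theta> i t)))
       - (\<Omega> j + \<kappa> * sin \<alpha> * (\<Sum>k\<in>nb j. cos (\<theta> k t - \<theta> j t))) \<le> drive_spread"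
proof -
  have "\<bar>\<Sum>k\<in>nb i. cos (\<theta> k t - \<theta> i t)\<bar> \<le> real N * 1" if "i \<in> {1..N}" for i
    using that by (intro abs_coupling_sum_le) auto
  from this[OF ij(1)] this[OF ij(2)]
  have "(\<Sum>k\<in>nb i. cos (\<theta> k t - \<theta> i t)) - (\<Sum>k\<in>nb j. cos (\<theta> k t - \<theta> j t)) \<le> 2 * real N"
    by linarith
  from mult_left_mono[OF this, of "\<kappa> * sin \<alpha>"] D_ge[OF ij, of \<Omega>] \<kappa> sin_\<alpha>
  show ?thesis by (simp add: drive_spread_def algebra_simps)
qed

lemma force_spread_le:
  assumes ij: "i \<in> {1..N}" "j \<in> {1..N}"
  shows "force i t - force j t \<le> drive_spread + 2 * real N * \<kappa> * D (\<lambda>i. \<theta> i t)"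
proof -
  let ?D = "D (\<lambda>i. \<theta> i t)"
  let ?S = "\<lambda>i. \<Sum>k\<in>nb i. sin (\<theta> k t - \<theta> i t)"
  have S: "\<bar>?S i\<bar> \<le> real N * ?D" if i: "i \<in> {1..N}" for i
  proof (intro abs_coupling_sum_le i D_nonneg)
    fix k assume "k \<in> nb i"
    then have "\<bar>\<theta> k t - \<theta> i t\<bar> \<le> ?D" using nb[OF i] i by (intro abs_diff_le_D) auto
    then show "\<bar>sin (\<theta> k t - \<theta> i t)\<bar> \<le> ?D" using abs_sin_x_le_abs_x order.trans by blast
  qed
  have "?S i - ?S j \<le> 2 * (real N * ?D)" using S[OF ij(1)] S[OF ij(2)] by linarith
  then have "\<kappa> * cos \<alpha> * (?S i - ?S j) \<le> \<kappa> * cos \<alpha> * (2 * (real N * ?D))"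
    using \<kappa> cos_\<alpha> by (intro mult_left_mono) auto
  also have "\<dots> \<le> \<kappa> * 1 * (2 * (real N * ?D))"
    using \<kappa> cos_\<alpha> D_nonneg by (intro mult_right_mono mult_left_mono) auto
  finally show ?thesis
    using drive_diff_le[OF ij, of t] unfolding force_split by (simp add: algebra_simps)
qed

text \<open>The sine of a difference of slow phases is that difference times a coefficient
  \<open>sin z / z \<in> [sin \<gamma> / \<gamma>, 1]\<close>. Replacing phases by slow phases costs at most the spread of
  \<open>v\<close>, because \<open>sin\<close> has Lipschitz constant 1.\<close>
lemma slow_phase_coupling:
  fixes v :: "nat \<Rightarrow> real"
  assumes \<gamma>: "0 < \<gamma>" "\<gamma> < pi" and u: "D (\<lambda>i. \<theta> i t + v i) \<le> \<gamma>"
  shows "lagged_coupling (\<kappa> * cos \<alpha>) (sin \<gamma> / \<gamma>) drive_spread (\<lambda>i. \<theta> i t + v i) v (\<lambda>i. force i t)"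
proof -
  define z where "z i j = (\<theta> j t + v j) - (\<theta> i t + v i)" for i j
  define r where "r i j = (if z i j = 0 then 1 else sin (z i j) / z i j)" for i j
  define d where "d i j = sin (\<theta> j t - \<theta> i t) - sin (z i j)" for i j
  define h where "h i = \<Omega> i + \<kappa> * sin \<alpha> * (\<Sum>k\<in>nb i. cos (\<theta> k t - \<theta> i t))" for i
  have rz: "r i j * z i j = sin (z i j)" for i j by (simp add: r_def)
  have "force i t = h i + \<kappa> * cos \<alpha> * (\<Sum>j\<in>nb i. r i j * z i j + d i j)" for i
    unfolding force_split h_def by (simp add: rz d_def)
  moreover have "sin \<gamma> / \<gamma> \<le> r i j \<and> r i j \<le> 1 \<and> \<bar>d i j\<bar> \<le> D v"
    if i: "i \<in> {1..N}" and j: "j \<in> nb i" for i j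
  proof -
    have jV: "j \<in> {1..N}" using nb[OF i] j by auto
    have z: "\<bar>z i j\<bar> \<le> \<gamma>"
      using abs_diff_le_D[OF jV i, of "\<lambda>i. \<theta> i t + v i"] u by (simp add: z_def)
    have sym: "sin (z i j) / z i j = sin \<bar>z i j\<bar> / \<bar>z i j\<bar>" by (auto simp: abs_if)
    have "sin \<gamma> / \<gamma> \<le> r i j"
      using sinc_antimono[of "\<bar>z i j\<bar>" \<gamma>] z \<gamma> sin_x_le_x[of \<gamma>] by (auto simp: r_def sym)
    moreover have "r i j \<le> 1"
      using sin_x_le_x[of "\<bar>z i j\<bar>"] by (auto simp: r_def sym divide_le_eq)
    moreover have "\<bar>d i j\<bar> \<le> D v"
    proof -
      have "\<bar>d i j\<bar> \<le> \<bar>v i - v j\<bar>"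
        using abs_sin_diff_le[of "\<theta> j t - \<theta> i t" "z i j"] by (simp add: d_def z_def algebra_simps)
      then show ?thesis using abs_diff_le_D[OF i jV, of v] by simp
    qed
    ultimately show ?thesis by simp
  qed
  moreover have "h i - h j \<le> drive_spread" if "i \<in> {1..N}" "j \<in> {1..N}" for i j
    using drive_diff_le[OF that] by (simp add: h_def)
  ultimately show ?thesis unfolding lagged_coupling_def z_def by blast
qed

text \<open>The barrier starts at \<open>(c - 1) / (c + 1) * \<gamma>\<close>, the largest level at which the slow phases are
  known to span at most \<open>\<gamma>\<close>, and decays at the rate of the energy to the level \<open>l\<close>, which
  balances the drive. As \<open>m * \<theta>' + \<theta>\<close> is the slow phase, the phases follow.\<close>
lemma phase_spread_eventually_le:
  assumes \<gamma>: "0 < \<gamma>" "\<gamma> < pi" "real N \<le> sin \<gamma> / \<gamma> * c"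
    and small: "8 * (real N)\<^sup>2 * (\<kappa> * cos \<alpha>) * m \<le> 1"
    and \<beta>: "\<beta> = 4 * real N * (\<kappa> * cos \<alpha>) * m"
    and rate: "rate (\<kappa> * cos \<alpha>) m > 0"
    and l: "(1 + \<beta>) * drive_spread < rate (\<kappa> * cos \<alpha>) m * l"
      "l < (c - 1) / (c + 1) * \<gamma>" "(c + 1) / (c - 1) * l < b"
    and init: "D (\<lambda>i. \<theta> i 0 + m * \<omega> i 0) + \<beta> * D (\<lambda>i. m * \<omega> i 0) < (c - 1) / (c + 1) * \<gamma>"
  obtains T where "T > 0" "\<And>t. t \<ge> T \<Longrightarrow> D (\<lambda>i. \<theta> i t) \<le> b"
proof -
  let ?A = "rate (\<kappa> * cos \<alpha>) m"
  define K where "K = (c - 1) / (c + 1) * \<gamma> - l"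
  define L where "L t = l + K * exp (- ?A * (t - 0))" for t
  have K: "K > 0" using l by (simp add: K_def)
  obtain b' where b': "(c + 1) / (c - 1) * l < b'" "b' < b" using dense[OF l(3)] by blast
  have cc: "(c + 1) / (c - 1) > 0" using c by simp
  have L_le: "(c + 1) / (c - 1) * L t \<le> \<gamma>" if "t \<ge> 0" for t
  proof -
    have "K * exp (- ?A * t) \<le> K * 1" using K rate that by (intro mult_left_mono) auto
    then have "L t \<le> (c - 1) / (c + 1) * \<gamma>" by (simp add: L_def K_def)
    then show ?thesis using c by (simp add: field_simps)
  qed
  have s: "0 \<le> sin \<gamma> / \<gamma>" using \<gamma> by (auto intro!: divide_nonneg_pos sin_ge_zero)
  have slow: "D (\<lambda>i. \<theta> i t + m * \<omega> i t) \<le> (c + 1) / (c - 1) * L t" if "t \<ge> 0" for t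
  proof (rule spread_energy_below_barrier[where t = t and start = 0 and f = force and m = m and
        x = "\<lambda>i t. \<theta> i t + m * \<omega> i t" and v = "\<lambda>i t. m * \<omega> i t" and
        L = L and L' = "\<lambda>t. - ?A * K * exp (- ?A * t)" and P = drive_spread, THEN conjunct1])
    fix i t assume i: "i \<in> {1..N}" and t: "(0::real) < t"
    have "force i t = \<omega> i t + m * a i t" using newton[OF i t] by (simp add: force_def)
    then show "((\<lambda>t. \<theta> i t + m * \<omega> i t) has_real_derivative force i t) (at t)"
      and "((\<lambda>t. m * \<omega> i t) has_real_derivative force i t - m * \<omega> i t / m) (at t)"
      using m by (auto intro!: derivative_eq_intros der_\<theta>[OF i t] der_\<omega>[OF i t])
  next
    fix t :: real
    show "(L has_real_derivative - ?A * K * exp (- ?A * t)) (at t)"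
      unfolding L_def by (auto intro!: derivative_eq_intros)
    show "(1 + \<beta>) * drive_spread - ?A * L t < - ?A * K * exp (- ?A * t)"
      using l(1) by (simp add: L_def algebra_simps)
  next
    fix t assume "(0::real) < t" "D (\<lambda>i. \<theta> i t + m * \<omega> i t) \<le> (c + 1) / (c - 1) * L t"
    then show "lagged_coupling (\<kappa> * cos \<alpha>) (sin \<gamma> / \<gamma>) drive_spread (\<lambda>i. \<theta> i t + m * \<omega> i t)
        (\<lambda>i. m * \<omega> i t) (\<lambda>i. force i t)"
      using L_le[of t] by (intro slow_phase_coupling \<gamma>) auto
  next
    show "D (\<lambda>i. \<theta> i 0 + m * \<omega> i 0) + \<beta> * D (\<lambda>i. m * \<omega> i 0) < L 0"
      using init by (simp add: L_def K_def)
  qed (use m \<kappa> cos_\<alpha> small rate s \<gamma> \<beta> that cont_\<theta> cont_\<omega> in \<open>auto simp: L_def intro!: continuous_intros\<close>)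
  obtain T where T: "T \<ge> 0" "\<And>t. t \<ge> T \<Longrightarrow> (c + 1) / (c - 1) * K * exp (- ?A * (t - 0)) \<le> b' - (c + 1) / (c - 1) * l"
    using exp_decay_eventually_le[of ?A "b' - (c + 1) / (c - 1) * l" "(c + 1) / (c - 1) * K" 0]
      rate b' K cc by (metis diff_gt_0_iff_gt less_imp_le mult_pos_pos)
  obtain T' where T': "T' \<ge> T" "\<And>t. t \<ge> T' \<Longrightarrow> D (\<lambda>i. \<theta> i t) \<le> b"
  proof (rule low_pass_spread_eventually_le[OF V m b'(2)])
    show "continuous_on {T..} (\<theta> i)" if "i \<in> {1..N}" for i
      using cont_\<theta>[OF that] T(1) by (auto elim: continuous_on_subset)
    show "(\<theta> i has_real_derivative ((\<theta> i t + m * \<omega> i t) - \<theta> i t) / m) (at t)"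
      if "i \<in> {1..N}" "T < t" for i t
      using der_\<theta>[OF that(1), of t] that T(1) m by simp
    show "D (\<lambda>i. \<theta> i t + m * \<omega> i t) \<le> b'" if "T < t" for t
    proof -
      have "(c + 1) / (c - 1) * L t \<le> b'"
        using T(2)[of t] that by (simp add: L_def algebra_simps)
      then show ?thesis using slow[of t] that T(1) by simp
    qed
  qed blast
  show ?thesis by (rule that[of "T' + 1"]) (use T T' in auto)
qed

text \<open>Differentiating the equation of motion gives the same structure one level up: \<open>force\<close> plays the
  slow state, \<open>m * a = force - \<omega>\<close> the lag, and the coefficients are
  \<open>cos (\<theta> j t - \<theta> i t + \<alpha>) \<in> [cos (b + \<alpha>), 1]\<close>. The natural frequencies have dropped out,
  so the drive is 0 and the energy decays exponentially. Half of the rate is given up to make the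
  barrier strict.\<close>
lemma frequency_spread_decays:
  assumes b: "0 \<le> b" "b + \<alpha> < pi / 2" "real N \<le> cos (b + \<alpha>) * c"
    and small: "8 * (real N)\<^sup>2 * \<kappa> * m \<le> 1" and rate: "rate \<kappa> m > 0"
    and t0: "t0 > 0" and \<theta>: "\<And>t. t \<ge> t0 \<Longrightarrow> D (\<lambda>i. \<theta> i t) \<le> b"
  obtains C where "C > 0" "\<And>t. t \<ge> t0 \<Longrightarrow> D (\<lambda>i. \<omega> i t) \<le> C * exp (- (rate \<kappa> m / 2) * (t - t0))"
proof -
  let ?A = "rate \<kappa> m"
  define \<beta> where "\<beta> = 4 * real N * \<kappa> * m"
  define f where "f i t = \<kappa> * (\<Sum>j\<in>nb i. cos (\<theta> j t - \<theta> i t + \<alpha>) * (\<omega> j t - \<omega> i t))" for i t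
  define v where "v i t = force i t - \<omega> i t" for i t
  define K where "K = D (\<lambda>i. force i t0) + \<beta> * D (\<lambda>i. v i t0) + 1"
  define L where "L t = K * exp (- (?A / 2) * (t - t0))" for t
  have \<beta>: "\<beta> > 0" using \<kappa> m N by (simp add: \<beta>_def)
  have K: "K > 0" using D_nonneg[of "\<lambda>i. force i t0"] D_nonneg[of "\<lambda>i. v i t0"] \<beta>
    by (simp add: K_def add_nonneg_pos)
  have der_force: "(force i has_real_derivative f i t) (at t)" if i: "i \<in> {1..N}" and t: "t > 0" for i t
  proof -
    have "((\<lambda>t. sin (\<theta> j t - \<theta> i t + \<alpha>)) has_real_derivative
        cos (\<theta> j t - \<theta> i t + \<alpha>) * (\<omega> j t - \<omega> i t)) (at t)" if "j \<in> nb i" for j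
    proof -
      have "j \<in> {1..N}" using nb[OF i] that by auto
      then show ?thesis by (auto intro!: derivative_eq_intros der_\<theta> i t)
    qed
    then have "(force i has_real_derivative 0 + f i t) (at t)"
      unfolding force_def f_def by (intro DERIV_add DERIV_const DERIV_cmult DERIV_sum)
    then show ?thesis by simp
  qed
  have der_v: "(v i has_real_derivative f i t - v i t / m) (at t)" if i: "i \<in> {1..N}" and t: "t > 0" for i t
  proof -
    have "v i t / m = a i t" using newton[OF i t] m by (simp add: v_def force_def field_simps)
    then show ?thesis unfolding v_def by (auto intro!: DERIV_diff der_force der_\<omega> i t)
  qed
  have coupling: "lagged_coupling \<kappa> (cos (b + \<alpha>)) 0 (\<lambda>i. force i t) (\<lambda>i. v i t) (\<lambda>i. f i t)"
    if t: "t \<ge> t0" for t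
  proof -
    define r where "r i j = cos (\<theta> j t - \<theta> i t + \<alpha>)" for i j
    define d where "d i j = r i j * (v i t - v j t)" for i j
    have "f i t = 0 + \<kappa> * (\<Sum>j\<in>nb i. r i j * (force j t - force i t) + d i j)" for i
      by (simp add: f_def r_def d_def v_def algebra_simps)
    moreover have "cos (b + \<alpha>) \<le> r i j \<and> r i j \<le> 1 \<and> \<bar>d i j\<bar> \<le> D (\<lambda>i. v i t)"
      if i: "i \<in> {1..N}" and j: "j \<in> nb i" for i j
    proof -
      have jV: "j \<in> {1..N}" using nb[OF i] j by auto
      have "\<bar>\<theta> j t - \<theta> i t\<bar> \<le> b" using abs_diff_le_D[OF jV i, of "\<lambda>i. \<theta> i t"] \<theta>[OF t] by simp
      then have "cos (b + \<alpha>) \<le> cos \<bar>\<theta> j t - \<theta> i t + \<alpha>\<bar>"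
        using \<alpha> b by (intro cos_monotone_0_pi_le) auto
      moreover have "\<bar>d i j\<bar> \<le> 1 * D (\<lambda>i. v i t)"
        unfolding d_def abs_mult r_def by (intro mult_mono abs_diff_le_D i jV) auto
      ultimately show ?thesis by (simp add: r_def)
    qed
    ultimately show ?thesis unfolding lagged_coupling_def by (intro exI[of _ r] exI[of _ d] exI[of _ "\<lambda>_. 0"]) simp
  qed
  have s: "0 \<le> cos (b + \<alpha>)" using b \<alpha> by (intro cos_ge_zero) auto
  have barrier: "D (\<lambda>i. force i t) \<le> (c + 1) / (c - 1) * L t \<and> \<beta> * D (\<lambda>i. v i t) \<le> L t" if "t \<ge> t0" for t
  proof (rule spread_energy_below_barrier[where t = t and start = t0 and f = f and m = m and
        x = force and v = v and L = L and L' = "\<lambda>t. - (?A / 2) * L t" and P = 0 and \<kappa> = \<kappa> and s = "cos (b + \<alpha>)"])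
    fix t
    show "(L has_real_derivative - (?A / 2) * L t) (at t)"
      unfolding L_def by (auto intro!: derivative_eq_intros)
    show "(1 + \<beta>) * 0 - ?A * L t < - (?A / 2) * L t" using rate K by (simp add: L_def)
  next
    show "continuous_on {t0..} (force i)" "continuous_on {t0..} (v i)" if "i \<in> {1..N}" for i
      using t0 by (auto intro!: continuous_at_imp_continuous_on
        DERIV_isCont[OF der_force[OF that]] DERIV_isCont[OF der_v[OF that]])
  qed (use \<kappa> m small rate s b(3) t0 der_force der_v coupling that in
      \<open>auto simp: \<beta>_def L_def K_def intro!: continuous_intros\<close>)
  show ?thesis
  proof (rule that[of "((c + 1) / (c - 1) + 1 / \<beta>) * K"])
    show "((c + 1) / (c - 1) + 1 / \<beta>) * K > 0" using K \<beta> c by (intro mult_pos_pos add_pos_pos) auto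
    fix t assume t: "t \<ge> t0"
    have "D (\<lambda>i. \<omega> i t) \<le> D (\<lambda>i. force i t) + D (\<lambda>i. v i t)"
    proof (rule D_le)
      fix i j assume ij: "i \<in> {1..N}" "j \<in> {1..N}"
      show "\<omega> i t - \<omega> j t \<le> D (\<lambda>i. force i t) + D (\<lambda>i. v i t)"
        using D_ge[OF ij, of "\<lambda>i. force i t"] D_ge[OF ij(2,1), of "\<lambda>i. v i t"] by (simp add: v_def)
    qed
    also have "\<dots> \<le> (c + 1) / (c - 1) * L t + L t / \<beta>"
      using barrier[OF t] \<beta> by (intro add_mono) (auto simp: field_simps)
    also have "\<dots> = ((c + 1) / (c - 1) + 1 / \<beta>) * K * exp (- (?A / 2) * (t - t0))"
      by (simp add: L_def algebra_simps)
    finally show "D (\<lambda>i. \<omega> i t) \<le> \<dots>" .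
  qed
qed

end

section \<open>Exponential frequency synchronisation\<close>

theorem theorem2p1:
  fixes N :: nat and G :: "nat pair_pre_digraph"
    and m \<kappa> \<alpha> :: real and \<Omega> \<theta>0 \<omega>0 :: "nat \<Rightarrow> real"
    and \<theta> \<omega> a :: "nat \<Rightarrow> real \<Rightarrow> real"
    and \<gamma> Dinf \<epsilon> \<eta> M\<^sub>N \<Lambda> :: real and c :: nat
    and D\<theta>0 D\<omega>0 Da0 D\<Omega> :: real
  assumes "N \<ge> 2"
    and "pair_digraph G" and "pverts G = {1..N}" and "strongly_connected (with_proj G)"
    and "m > 0" and "\<kappa> > 0" and "0 < \<alpha>" and "\<alpha> < pi / 2"
    and "inertial_kuramoto_solution G m \<kappa> \<alpha> \<Omega> \<theta>0 \<omega>0 \<theta> \<omega> a"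
    and "D\<theta>0 = diam {1..N} (\<lambda>i. \<theta> i 0)" and "D\<omega>0 = diam {1..N} (\<lambda>i. \<omega> i 0)"
    and "Da0 = diam {1..N} (\<lambda>i. a i 0)" and "D\<Omega> = diam {1..N} \<Omega>"
    and "D\<theta>0 < pi"
    and "D\<theta>0 < \<gamma>" and "\<gamma> < pi" and "\<gamma> > 0"
    and "0 < Dinf" and "Dinf < pi / 2" and "Dinf + \<alpha> < pi / 2"
    and "0 < \<epsilon>" and "\<epsilon> < 1" and "c > 2"
    and "\<eta> = 1 - 4 / (real c + 2)"
    and "M\<^sub>N = (\<Prod>i=0..N-2. real c + real i)"
    and "\<Lambda> = Min {\<eta> * \<kappa> * cos \<alpha> * sin \<gamma> / (\<gamma> * M\<^sub>N),
                  1 / m - 8 * (real N)\<^sup>2 * \<kappa> * \<gamma> * M\<^sub>N / (\<eta> ^ 3 * sin \<gamma>),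
                  1 / (2 * m)}"
    and "real c > max (real N * \<gamma> / sin \<gamma>) (real N / cos (Dinf + \<alpha>))"
    and "D\<theta>0 < \<eta> * (1 - \<epsilon>) * \<gamma>"
    and "m * \<kappa> < \<eta> ^ 3 / (8 * (real N)\<^sup>2 * M\<^sub>N) * min (sin \<gamma> / \<gamma>) (cos (Dinf + \<alpha>))"
    and "D\<theta>0 + \<eta>\<^sup>2 * sin \<gamma> / (2 * real N * \<gamma> * M\<^sub>N) * m * D\<omega>0 + 2 * m\<^sup>2 * Da0
           < \<eta> * (1 - \<epsilon>) * \<gamma>"
    and "\<eta> * (1 - \<epsilon>) * \<gamma> < pi"
    and "2 * (D\<Omega> + 2 * real N * \<kappa> * sin \<alpha>) / (\<eta> * \<Lambda>) < min ((1 - \<epsilon>) * \<gamma>) (Dinf / 2)"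
    and "4 * real N * m * M\<^sub>N * (D\<omega>0 + D\<Omega>) + 8 * (real N)\<^sup>2 * m * \<kappa> * M\<^sub>N
           < \<eta>\<^sup>2 * cos (Dinf + \<alpha>)"
  shows "\<exists>ts\<ge>0. \<exists>C>0. \<exists>L>0. \<forall>t\<ge>ts.
           diam {1..N} (\<lambda>i. \<omega> i t) \<le> C * exp (- L * (t - ts))"
proof -
  note N = assms(1) and m = assms(5) and \<kappa> = assms(6) and \<alpha> = assms(7,8) and \<gamma> = assms(17,16)
    and c2 = assms(23) and sol = assms(9)[unfolded inertial_kuramoto_solution_def assms(3)]
  have der_\<theta>: "(\<theta> i has_real_derivative \<omega> i t) (at t within {0..})" if "i \<in> {1..N}" "t \<ge> 0" for i t
    using sol that by blast
  interpret inertial_kuramoto_network N "neighbors G" "real c" m \<kappa> \<alpha> \<Omega> \<theta> \<omega> a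
  proof
    show "neighbors G i \<subseteq> {1..N}" for i
    proof -
      interpret pair_digraph G by (rule assms(2))
      show ?thesis using in_arcsD1 assms(3) by (auto simp: neighbors_def)
    qed
    show "\<exists>i\<in>S. \<exists>j\<in>neighbors G i. j \<notin> S" if "S \<subset> {1..N}" "S \<noteq> {}" for S
      using strongly_connected_cut[OF assms(4), of S] that assms(3) by simp
    fix i assume i: "i \<in> {1..N}"
    show "continuous_on {0..} (\<theta> i)" using der_\<theta>[OF i] by (intro DERIV_continuous_on) auto
    show "continuous_on {0..} (\<omega> i)" using sol i by blast
    fix t :: real assume t: "t > 0"
    have "at t within {0..} = at t" using t by (intro at_within_nhd[of t "{0<..}"]) auto
    then show "(\<theta> i has_real_derivative \<omega> i t) (at t)" using der_\<theta>[OF i, of t] t by simp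
    show "(\<omega> i has_real_derivative a i t) (at t)" using sol i t by blast
    show "m * a i t + \<omega> i t = \<Omega> i + \<kappa> * (\<Sum>j\<in>neighbors G i. sin (\<theta> j t - \<theta> i t + \<alpha>))"
      using sol i t unfolding kuramoto_rhs_def by blast
  qed (use N c2 m \<kappa> \<alpha> in auto)

  define s where "s = sin \<gamma> / \<gamma>"
  define \<kappa>' where "\<kappa>' = \<kappa> * cos \<alpha>"
  define \<eta>' where "\<eta>' = (real c - 1) / (real c + 1)"
  define q where "q = 8 * (real N)\<^sup>2 * \<kappa> * m"
  define \<mu> where "\<mu> = min \<gamma> (Dinf / 2)"
  have c3: "real c \<ge> 3" using c2 by simp
  have sin\<gamma>: "sin \<gamma> > 0" using \<gamma> by (intro sin_gt_zero)
  have s: "0 < s" "s \<le> 1" using sin\<gamma> \<gamma> sin_x_le_x[of \<gamma>] by (auto simp: s_def)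
  have cosD: "cos (Dinf + \<alpha>) > 0" using assms(18,20) \<alpha> by (intro cos_gt_zero) auto
  have \<kappa>': "0 < \<kappa>'" "\<kappa>' \<le> \<kappa>" using \<kappa> cos_\<alpha> by (auto simp: \<kappa>'_def)
  have \<eta>_eq: "\<eta> = (real c - 2) / (real c + 2)" using assms(24) by (simp add: field_simps)
  have \<eta>: "0 < \<eta>" "\<eta> < 1" using c3 by (auto simp: \<eta>_eq)
  have gap: "\<eta>' - \<eta> = 2 * real c / ((real c + 1) * (real c + 2))"
    using c3 unfolding \<eta>'_def \<eta>_eq by (simp add: divide_simps) (simp add: algebra_simps)
  have \<eta>': "\<eta> < \<eta>'"
  proof -
    have "\<eta>' - \<eta> > 0" unfolding gap using c3 by (intro divide_pos_pos) auto
    then show ?thesis by simp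
  qed
  have M: "M\<^sub>N \<ge> real c"
  proof -
    have "(1 + real c) ^ 1 * real c \<le> (1 + real c) ^ (N - 1) * real c"
      using N c3 by (intro mult_right_mono power_increasing) auto
    also have "\<dots> \<le> (1 + real c) * M\<^sub>N" unfolding assms(25) using N c3 by (intro power_le_rising_product) auto
    finally show ?thesis using c3 by simp
  qed
  then have Mpos: "M\<^sub>N > 0" using c3 by simp
  have \<mu>: "0 < \<mu>" "\<mu> \<le> \<gamma>" "\<mu> \<le> Dinf / 2" using \<gamma> assms(18) by (auto simp: \<mu>_def)

  \<comment> \<open>The inertia hypothesis in the two forms used: \<open>q_s\<close> makes \<open>\<Lambda>\<close> positive, and \<open>q\<close> keeps the feedback of the lag below the dissipation.\<close>
  have q_s: "q < \<eta> ^ 3 * s / M\<^sub>N"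
  proof -
    have "m * \<kappa> < \<eta> ^ 3 / (8 * (real N)\<^sup>2 * M\<^sub>N) * s"
      using \<eta> Mpos by (intro less_le_trans[OF assms(29) mult_left_mono]) (auto simp: s_def)
    then have "8 * (real N)\<^sup>2 * (m * \<kappa>) < 8 * (real N)\<^sup>2 * (\<eta> ^ 3 / (8 * (real N)\<^sup>2 * M\<^sub>N) * s)"
      using N by (intro mult_strict_left_mono) auto
    then show ?thesis using N by (simp add: q_def mult_ac)
  qed
  have q: "q \<le> \<eta> / M\<^sub>N"
  proof -
    have "\<eta> ^ 3 * s \<le> \<eta> ^ 1 * 1" using \<eta> s by (intro mult_mono power_decreasing) auto
    then have "\<eta> ^ 3 * s / M\<^sub>N \<le> \<eta> / M\<^sub>N" using Mpos by (intro divide_right_mono) auto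
    then show ?thesis using q_s by simp
  qed
  have q1: "q \<le> 1"
    using q \<eta> M c3 by (intro order.trans[OF q]) (simp add: divide_le_eq)
  have q': "8 * (real N)\<^sup>2 * \<kappa>' * m \<le> q"
    unfolding q_def using \<kappa>' m by (intro mult_right_mono mult_left_mono) auto
  have rates: "\<kappa>' / M\<^sub>N \<le> rate \<kappa>' m" "\<kappa> / M\<^sub>N \<le> rate \<kappa> m"
    using rate_ge[OF _ assms(25), of \<kappa>' \<kappa>] rate_ge[OF _ assms(25), of \<kappa> \<kappa>] c3 \<kappa> \<kappa>' m q
    by (auto simp: \<eta>_eq q_def)
  then have rate_pos: "rate \<kappa>' m > 0" "rate \<kappa> m > 0"
    using divide_pos_pos[OF \<kappa>'(1) Mpos] divide_pos_pos[OF \<kappa> Mpos] by linarith+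

  have P_eq: "drive_spread = D\<Omega> + 2 * real N * \<kappa> * sin \<alpha>" by (simp add: drive_spread_def assms(13))
  have P0: "drive_spread \<ge> 0"
    unfolding drive_spread_def using D_nonneg[of \<Omega>] \<kappa> sin_\<alpha> by (intro add_nonneg_nonneg mult_nonneg_nonneg) auto
  have \<Lambda>_le: "\<Lambda> \<le> \<eta> * \<kappa>' / M\<^sub>N"
  proof -
    have "\<Lambda> \<le> \<eta> * \<kappa> * cos \<alpha> * sin \<gamma> / (\<gamma> * M\<^sub>N)" unfolding assms(26) by (intro Min_le) auto
    also have "\<dots> = \<eta> * \<kappa>' / M\<^sub>N * s" by (simp add: \<kappa>'_def s_def mult_ac)
    also have "\<dots> \<le> \<eta> * \<kappa>' / M\<^sub>N * 1" using s \<eta> \<kappa>' Mpos by (intro mult_left_mono) auto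
    finally show ?thesis by simp
  qed
  have \<Lambda>_pos: "\<Lambda> > 0"
  proof -
    have "8 * (real N)\<^sup>2 * \<kappa> * \<gamma> * M\<^sub>N / (\<eta> ^ 3 * sin \<gamma>) = q * M\<^sub>N / (\<eta> ^ 3 * s) / m"
      using m \<gamma> by (simp add: q_def s_def field_simps)
    also have "\<dots> < 1 / m"
      using q_s Mpos \<eta> s m by (intro divide_strict_right_mono) (auto simp: field_simps)
    finally show ?thesis
      unfolding assms(26) using m \<eta> \<kappa> cos_\<alpha> sin\<gamma> \<gamma> Mpos by simp
  qed
  \<comment> \<open>The coupling hypothesis says that the drive is weak against the dissipation; it makes \<open>\<eta>\<^sup>2 * \<mu>\<close> an admissible level for the barrier, as \<open>level\<close> shows.\<close>
  have P: "2 * drive_spread < \<eta>\<^sup>2 * \<kappa>' / M\<^sub>N * \<mu>"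
  proof -
    have "(1 - \<epsilon>) * \<gamma> \<le> \<gamma>" using assms(21) \<gamma> by simp
    then have "2 * drive_spread / (\<eta> * \<Lambda>) < \<mu>" using assms(32) unfolding P_eq \<mu>_def by linarith
    then have "2 * drive_spread < \<eta> * \<Lambda> * \<mu>" using \<eta> \<Lambda>_pos by (simp add: pos_divide_less_eq mult_ac)
    also have "\<dots> \<le> \<eta> * (\<eta> * \<kappa>' / M\<^sub>N) * \<mu>"
      using \<Lambda>_le \<eta> \<mu> by (intro mult_right_mono mult_left_mono) auto
    finally show ?thesis by (simp add: power2_eq_square)
  qed

  define \<beta> where "\<beta> = 4 * real N * \<kappa>' * m"
  have \<beta>: "0 \<le> \<beta>" "\<beta> \<le> 1"
  proof -
    show "0 \<le> \<beta>" using \<kappa>' m by (simp add: \<beta>_def)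
    have "4 * real N * \<kappa>' * m \<le> 8 * (real N * real N) * \<kappa>' * m"
      using N \<kappa>' m by (intro mult_right_mono) auto
    then show "\<beta> \<le> 1" using q'[unfolded power2_eq_square] q1 unfolding \<beta>_def by linarith
  qed
  have level: "(1 + \<beta>) * drive_spread < rate \<kappa>' m * (\<eta>\<^sup>2 * \<mu>)"
  proof -
    have "(1 + \<beta>) * drive_spread \<le> 2 * drive_spread" using \<beta> P0 by (intro mult_right_mono) auto
    also have "\<dots> < \<kappa>' / M\<^sub>N * (\<eta>\<^sup>2 * \<mu>)" using P by (simp add: mult_ac)
    also have "\<dots> \<le> rate \<kappa>' m * (\<eta>\<^sup>2 * \<mu>)" using rates \<mu> by (intro mult_right_mono) auto
    finally show ?thesis .
  qed
  have \<eta>2: "\<eta>\<^sup>2 < \<eta>'"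
    using \<eta> \<eta>' by (auto simp: power2_eq_square intro: le_less_trans[of _ "\<eta> * 1"])

  \<comment> \<open>Initially \<open>m * \<omega> = m * force - m\<^sup>2 * a\<close>, and \<open>m * force\<close> has a tiny spread. Hence the hypothesis on the initial accelerations bounds the spread of the slow phases by \<open>\<eta> * \<gamma>\<close> up to a small error, for which the gap between \<open>\<eta>\<close> and \<open>\<eta>'\<close> leaves room.\<close>
  have init: "D (\<lambda>i. \<theta> i 0 + m * \<omega> i 0) + \<beta> * D (\<lambda>i. m * \<omega> i 0) < \<eta>' * \<gamma>"
  proof -
    let ?W = "D (\<lambda>i. m * \<omega> i 0)"
    have "?W \<le> m * (drive_spread + 2 * real N * \<kappa> * \<gamma>) + m\<^sup>2 * Da0"
    proof (rule D_le)
      fix i j assume ij: "i \<in> {1..N}" "j \<in> {1..N}"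
      have ic: "m * \<omega> i 0 = m * force i 0 - m\<^sup>2 * a i 0" if "i \<in> {1..N}" for i
      proof -
        have "a i 0 = (1 / m) * (- \<omega> i 0 + force i 0)"
          using sol that unfolding kuramoto_rhs_def force_def by blast
        then have "m * a i 0 = force i 0 - \<omega> i 0" using m by simp
        then have "m * (m * a i 0) = m * (force i 0 - \<omega> i 0)" by simp
        then show ?thesis by (simp add: power2_eq_square algebra_simps)
      qed
      have "force i 0 - force j 0 \<le> drive_spread + 2 * real N * \<kappa> * D (\<lambda>i. \<theta> i 0)"
        by (rule force_spread_le[OF ij])
      also have "\<dots> \<le> drive_spread + 2 * real N * \<kappa> * \<gamma>"
        using assms(10,15) \<kappa> by (intro add_left_mono mult_left_mono) auto
      finally have "m * (force i 0 - force j 0) \<le> m * (drive_spread + 2 * real N * \<kappa> * \<gamma>)"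
        using m by simp
      moreover have "m\<^sup>2 * (a j 0 - a i 0) \<le> m\<^sup>2 * Da0"
        using D_ge[OF ij(2,1), of "\<lambda>i. a i 0"] assms(12) by (intro mult_left_mono) auto
      ultimately show "m * \<omega> i 0 - m * \<omega> j 0 \<le> m * (drive_spread + 2 * real N * \<kappa> * \<gamma>) + m\<^sup>2 * Da0"
        unfolding ic[OF ij(1)] ic[OF ij(2)] by (simp add: algebra_simps)
    qed
    moreover have "D (\<lambda>i. \<theta> i 0 + m * \<omega> i 0) \<le> D\<theta>0 + ?W"
    proof (rule D_le)
      fix i j assume ij: "i \<in> {1..N}" "j \<in> {1..N}"
      show "\<theta> i 0 + m * \<omega> i 0 - (\<theta> j 0 + m * \<omega> j 0) \<le> D\<theta>0 + ?W"
        using D_ge[OF ij, of "\<lambda>i. \<theta> i 0"] D_ge[OF ij, of "\<lambda>i. m * \<omega> i 0"] assms(10) by simp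
    qed
    moreover have "\<beta> * ?W \<le> 1 * ?W" using \<beta> D_nonneg by (intro mult_right_mono)
    ultimately have "D (\<lambda>i. \<theta> i 0 + m * \<omega> i 0) + \<beta> * ?W
        \<le> (D\<theta>0 + 2 * m\<^sup>2 * Da0) + m * (2 * drive_spread) + 4 * real N * \<kappa> * m * \<gamma>"
      by (simp add: algebra_simps)
    also have "\<dots> \<le> \<eta> * \<gamma> + m * (\<kappa> * \<gamma>) + 4 * real N * \<kappa> * m * \<gamma>"
    proof (intro add_mono mult_left_mono order.refl)
      have "0 \<le> \<eta>\<^sup>2 * sin \<gamma> / (2 * real N * \<gamma> * M\<^sub>N) * m * D\<omega>0"
        using sin\<gamma> \<gamma> Mpos m D_nonneg[of "\<lambda>i. \<omega> i 0"] assms(11)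
        by (intro mult_nonneg_nonneg divide_nonneg_nonneg) auto
      moreover have "\<eta> * (1 - \<epsilon>) * \<gamma> \<le> \<eta> * 1 * \<gamma>"
        using \<eta> \<gamma> assms(21) by (intro mult_right_mono mult_left_mono) auto
      ultimately show "D\<theta>0 + 2 * m\<^sup>2 * Da0 \<le> \<eta> * \<gamma>" using assms(30) by simp
      have "\<eta>\<^sup>2 * \<kappa>' / M\<^sub>N * \<mu> \<le> 1 * \<kappa> / 1 * \<gamma>"
        using \<eta> \<kappa>' \<kappa> M c3 \<mu> by (intro mult_mono frac_le) (auto simp: power_le_one)
      then show "2 * drive_spread \<le> \<kappa> * \<gamma>" using P by simp
    qed (use m \<kappa> in simp_all)
    also have "\<dots> = \<eta> * \<gamma> + (4 * real N + 1) * (\<kappa> * m) * \<gamma>" by (simp add: algebra_simps)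
    also have "\<dots> < \<eta> * \<gamma> + (\<eta>' - \<eta>) * \<gamma>"
    proof (intro add_strict_left_mono mult_strict_right_mono)
      have "4 * real N + 1 \<le> 8 * (real N)\<^sup>2"
      proof -
        have "2 * real N \<le> real N * real N" "2 \<le> real N" using N by auto
        then show ?thesis unfolding power2_eq_square by linarith
      qed
      then have "(4 * real N + 1) * (\<kappa> * m) \<le> 8 * (real N)\<^sup>2 * (\<kappa> * m)"
        using \<kappa> m by (intro mult_right_mono) auto
      also have "\<dots> = q" by (simp only: q_def mult.assoc)
      also note q
      also have "\<eta> / M\<^sub>N \<le> \<eta> / real c"
        using M Mpos \<eta> c3 by (intro divide_left_mono mult_pos_pos) linarith+
      also have "\<dots> < \<eta>' - \<eta>"
      proof -
        have "(real c - 2) / real c < 2 * real c / (real c + 1)"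
          by (rule less_le_trans[of _ 1]) (use c3 in auto)
        then have "(real c - 2) / real c / (real c + 2) < 2 * real c / (real c + 1) / (real c + 2)"
          using c3 by (intro divide_strict_right_mono) auto
        then show ?thesis unfolding gap unfolding \<eta>_eq by (simp add: mult_ac)
      qed
      finally show "(4 * real N + 1) * (\<kappa> * m) < \<eta>' - \<eta>" .
    qed (use \<gamma> in simp)
    finally show ?thesis by (simp add: algebra_simps)
  qed

  obtain T where T: "T > 0" "\<And>t. t \<ge> T \<Longrightarrow> D (\<lambda>i. \<theta> i t) \<le> Dinf"
  proof (rule phase_spread_eventually_le[of \<gamma> \<beta> "\<eta>\<^sup>2 * \<mu>" Dinf])
    show "real N \<le> sin \<gamma> / \<gamma> * real c"
      using assms(27) sin\<gamma> \<gamma> by (simp add: field_simps)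
    show "\<eta>\<^sup>2 * \<mu> < (real c - 1) / (real c + 1) * \<gamma>"
      using mult_strict_right_mono[OF \<eta>2 \<mu>(1)] mult_left_mono[OF \<mu>(2), of \<eta>'] \<eta> \<eta>'
      by (simp add: \<eta>'_def)
    have "\<eta>\<^sup>2 * \<mu> < \<eta>' * Dinf"
      using \<eta>2 \<eta> \<eta>' \<mu> assms(18) by (intro mult_strict_mono) auto
    then have "1 / \<eta>' * (\<eta>\<^sup>2 * \<mu>) < Dinf" using \<eta> \<eta>' by (simp add: pos_divide_less_eq mult_ac)
    then show "(real c + 1) / (real c - 1) * (\<eta>\<^sup>2 * \<mu>) < Dinf" by (simp add: \<eta>'_def)
  qed (use \<gamma> q' q1 rate_pos level init in \<open>auto simp: \<beta>_def \<kappa>'_def \<eta>'_def\<close>)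
  obtain C where C: "C > 0"
      "\<And>t. t \<ge> T \<Longrightarrow> D (\<lambda>i. \<omega> i t) \<le> C * exp (- (rate \<kappa> m / 2) * (t - T))"
  proof (rule frequency_spread_decays[of Dinf T])
    show "real N \<le> cos (Dinf + \<alpha>) * real c" using assms(27) cosD by (simp add: field_simps)
    show "8 * (real N)\<^sup>2 * \<kappa> * m \<le> 1" using q1 by (simp add: q_def)
  qed (use assms(18,20) rate_pos T in auto)
  show ?thesis
    using T(1) C rate_pos(2) by (intro exI[of _ T] exI[of _ C] exI[of _ "rate \<kappa> m / 2"] conjI) auto
qed

end
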